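(* Let $G$ be a connected graph of order at least $3$ with $m$ edges. Then: (1) $rx_3(G)=m$ if and only if $G$ is a tree. (2) $rx_3(G)=m-1$ if and only if $G$ is a unicyclic graph with girth $3$. (3) $rx_3(G)=m-2$ if and only if $G$ is a unicyclic graph with girth at least $4$.
   Context: All graphs are finite, simple and undirected. Edge-colorings are arbitrary maps from $E(G)$ to a finite set of colors (adjacent edges may receive the same color). A tree $T$ that is a subgraph of an edge-colored graph $G$ is a rainbow tree if no two edges of $T$ have the same color. For $S\subseteq V(G)$, a rainbow $S$-tree is a rainbow tree in $G$ whose vertex set contains $S$ (it may contain other vertices). For a connected graph $G$ of order at least $3$, $rx_3(G)$ (the $3$-rainbow index) is the minimum number of colors in an edge-coloring of $G$ such that for every $3$-element subset $S$ of $V(G)$ there is a rainbow $S$-tree. A unicyclic graph is a connected graph containing exactly one cycle; its girth is the length of that cycle. *)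

theory Defs
  imports Main
begin

text \<open>
  A finite simple undirected graph is given by a vertex set \<open>V\<close> and a set \<open>E\<close> of
  two-element subsets of \<open>V\<close>.
\<close>

definition simple_graph :: "'a set \<Rightarrow> 'a set set \<Rightarrow> bool" where
  "simple_graph V E \<longleftrightarrow> finite V \<and> (\<forall>e\<in>E. e \<subseteq> V \<and> card e = 2)"

definition connected_graph :: "'a set \<Rightarrow> 'a set set \<Rightarrow> bool" where
  "connected_graph V E \<longleftrightarrow>
     simple_graph V E \<and> V \<noteq> {} \<and> (\<forall>u\<in>V. \<forall>v\<in>V. (u, v) \<in> {(x, y). {x, y} \<in> E}\<^sup>*)"

definition cyclic_edges :: "'a list \<Rightarrow> 'a set set" where
  "cyclic_edges xs = {{xs ! i, xs ! (Suc i mod length xs)} | i. i < length xs}"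

text \<open>
  A cycle is identified with its edge set, so that the rotations and reversals of a cyclic
  vertex sequence all denote the same cycle. Its length is the cardinality of that set.
\<close>

definition is_cycle :: "'a set set \<Rightarrow> 'a set set \<Rightarrow> bool" where
  "is_cycle E C \<longleftrightarrow>
     C \<subseteq> E \<and> (\<exists>xs. distinct xs \<and> 3 \<le> length xs \<and> C = cyclic_edges xs)"

definition is_tree :: "'a set \<Rightarrow> 'a set set \<Rightarrow> bool" where
  "is_tree V E \<longleftrightarrow> connected_graph V E \<and> (\<nexists>C. is_cycle E C)"

definition unicyclic :: "'a set \<Rightarrow> 'a set set \<Rightarrow> bool" where
  "unicyclic V E \<longleftrightarrow> connected_graph V E \<and> (\<exists>!C. is_cycle E C)"

text \<open>Only meaningful for graphs with exactly one cycle.\<close>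

definition unicyclic_girth :: "'a set set \<Rightarrow> nat" where
  "unicyclic_girth E = card (THE C. is_cycle E C)"

definition rainbow_tree ::
  "'a set \<Rightarrow> 'a set set \<Rightarrow> ('a set \<Rightarrow> 'c) \<Rightarrow> 'a set \<Rightarrow> 'a set set \<Rightarrow> bool" where
  "rainbow_tree V E c W F \<longleftrightarrow> W \<subseteq> V \<and> F \<subseteq> E \<and> is_tree W F \<and> inj_on c F"

definition has_rainbow_S_tree ::
  "'a set \<Rightarrow> 'a set set \<Rightarrow> ('a set \<Rightarrow> 'c) \<Rightarrow> 'a set \<Rightarrow> bool" where
  "has_rainbow_S_tree V E c S \<longleftrightarrow> (\<exists>W F. rainbow_tree V E c W F \<and> S \<subseteq> W)"

definition rainbow3_coloring :: "'a set \<Rightarrow> 'a set set \<Rightarrow> ('a set \<Rightarrow> 'c) \<Rightarrow> bool" where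
  "rainbow3_coloring V E c \<longleftrightarrow> (\<forall>S. S \<subseteq> V \<and> card S = 3 \<longrightarrow> has_rainbow_S_tree V E c S)"

definition rx3 :: "'a set \<Rightarrow> 'a set set \<Rightarrow> nat" where
  "rx3 V E = (LEAST k. \<exists>c :: 'a set \<Rightarrow> nat. c ` E \<subseteq> {..<k} \<and> rainbow3_coloring V E c)"

end

theory Submission
  imports Defs
begin

text \<open>
  Pruning a connected edge set to a spanning tree of one component shows that \<open>S\<close> has a rainbow
  tree exactly when some edge set with pairwise distinct colours links the vertices of \<open>S\<close> to each
  other (\<open>has_rainbow_S_tree_iff\<close>). So the index is about rainbow edge sets and connectivity, and
  trees need not be handled explicitly.

  Lower bounds. Every bridge has a far end, a vertex whose connections to a given root all use the
  bridge. A rainbow set linking the far ends of two bridges to the root contains both bridges, so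
  bridges have pairwise distinct colours (\<open>bridges_inj_on\<close>). In a tree every edge is a bridge, so
  there are as many colours as edges. A unicyclic graph projects onto its cycle by sending a vertex to the
  cycle vertex below it. If a connected set misses two cycle edges, then all vertices that it links
  project to the same one of the two arcs between the missing edges (\<open>two_gaps\<close>). Two consequences
  follow. First, the missing edges of a set linking three prescribed vertices lie in a single arc
  between these vertices, so by a good choice of the vertices at most \<open>d\<close> of any \<open>3 * d\<close> given cycle
  edges are missed (\<open>three_cuts\<close>). But if the cycle saves many colours, there are few edges of which
  every rainbow set misses more than \<open>d\<close> (\<open>crowded_colours\<close>). Second, at most one bridge shares its
  colour with a cycle edge, and with only one, and this single coincidence can be paid for in the
  same counting argument. The outcome is that a unicyclic graph saves at most two colours,
  and at most one if the cycle is a triangle (\<open>unicyclic_lower_bound\<close>).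

  Upper bounds. Colouring a spanning connected subgraph suffices, so deleting an edge of a
  cycle saves a colour. A cycle with at least four edges saves two colours: repeat the colours of
  its first two edges on the next two (\<open>rx3_long_cycle\<close>). If there are two cycles, three colours can be
  saved. When one of the cycles is long, delete an edge of the other one and use the previous
  saving. Otherwise all cycles are triangles, and any two of them are edge-disjoint, as two triangles
  with a common edge contain a 4-cycle. Giving two disjoint triangles the same three colours saves
  three, because three vertices cannot meet all four branches that hang off the far corners of the
  two triangles (\<open>rx3_two_triangles_based\<close>).
\<close>

section \<open>Connectivity inside an edge set\<close>

definition conn :: "'a set set \<Rightarrow> 'a \<Rightarrow> 'a \<Rightarrow> bool" where
  "conn F u v \<longleftrightarrow> (u, v) \<in> {(x, y). {x, y} \<in> F}\<^sup>*"

definition links :: "'a set set \<Rightarrow> 'a set \<Rightarrow> bool" where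
  "links F S \<longleftrightarrow> (\<forall>s\<in>S. \<forall>t\<in>S. conn F s t)"

lemma conn_refl [simp]: "conn F u u"
  by (simp add: conn_def)

lemma conn_edge: "{u, v} \<in> F \<Longrightarrow> conn F u v"
  by (auto simp: conn_def)

lemma conn_trans: "conn F u v \<Longrightarrow> conn F v w \<Longrightarrow> conn F u w"
  by (auto simp: conn_def)

lemma conn_sym: "conn F u v \<Longrightarrow> conn F v u"
proof -
  have "sym {(x, y). {x, y} \<in> F}"
    by (auto simp: sym_def insert_commute)
  then show "conn F u v \<Longrightarrow> conn F v u"
    unfolding conn_def by (meson sym_rtrancl symD)
qed

lemma conn_induct [consumes 1, case_names refl step]:
  assumes "conn F u v" "P u"
    and "\<And>a b. conn F u a \<Longrightarrow> P a \<Longrightarrow> {a, b} \<in> F \<Longrightarrow> P b"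
  shows "P v"
  using assms(1) unfolding conn_def
proof (induction rule: rtrancl_induct)
  case base
  show ?case by (rule assms(2))
next
  case (step y z)
  then show ?case using assms(3)[of y z] by (auto simp: conn_def)
qed

text \<open>
  Only edges that are reachable from the starting point have to be replaced. This is what allows a
  connection to be transferred to a graph that lacks edges outside its component.
\<close>

lemma conn_simulate:
  assumes "conn F u v" and "\<And>a b. conn F u a \<Longrightarrow> {a, b} \<in> F \<Longrightarrow> conn G a b"
  shows "conn G u v"
  using assms(1)
proof (induction rule: conn_induct)
  case (step a b)
  then show ?case using assms(2) conn_trans by metis
qed simp

lemma conn_mono: "conn F u v \<Longrightarrow> F \<subseteq> G \<Longrightarrow> conn G u v"
  by (erule conn_simulate) (auto intro: conn_edge)

text \<open>
  The way to show that two vertices are not connected: separate them by a quantity that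
  no edge changes.
\<close>

lemma conn_invariant:
  assumes "conn F u v" and "\<And>a b. {a, b} \<in> F \<Longrightarrow> P a = P b"
  shows "P u = P v"
  using assms(1)
proof (induction rule: conn_induct)
  case (step a b)
  then show ?case using assms(2)[of a b] by metis
qed simp

lemma links_from_root: "(\<And>s. s \<in> S \<Longrightarrow> conn F s r) \<Longrightarrow> links F S"
  unfolding links_def using conn_sym conn_trans by metis

lemma connected_graph_iff:
  "connected_graph V E \<longleftrightarrow> simple_graph V E \<and> V \<noteq> {} \<and> links E V"
  unfolding connected_graph_def links_def conn_def by simp

lemma connected_graph_conn: "connected_graph V E \<Longrightarrow> u \<in> V \<Longrightarrow> v \<in> V \<Longrightarrow> conn E u v"
  by (simp add: connected_graph_iff links_def)

lemma connected_graph_subset: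
  assumes "connected_graph V E" "E' \<subseteq> E" and "\<And>a b. {a, b} \<in> E \<Longrightarrow> conn E' a b"
  shows "connected_graph V E'"
  using assms unfolding connected_graph_iff links_def simple_graph_def
  by (meson conn_simulate subsetD)

lemma finite_vertices: "connected_graph V E \<Longrightarrow> finite V"
  by (simp add: connected_graph_iff simple_graph_def)

lemma edge_subset: "connected_graph V E \<Longrightarrow> e \<in> E \<Longrightarrow> e \<subseteq> V"
  by (simp add: connected_graph_iff simple_graph_def)

lemma card_edge: "connected_graph V E \<Longrightarrow> e \<in> E \<Longrightarrow> card e = 2"
  by (simp add: connected_graph_iff simple_graph_def)

lemma finite_edges: "connected_graph V E \<Longrightarrow> finite E"
  by (rule finite_subset[of _ "Pow V"]) (auto dest: edge_subset finite_vertices)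

lemma edge_ends:
  assumes "connected_graph V E" "e \<in> E"
  obtains u v where "e = {u, v}" "u \<noteq> v" "u \<in> V" "v \<in> V"
proof -
  obtain u v where "e = {u, v}" "u \<noteq> v" using card_edge[OF assms] by (auto simp: card_2_iff)
  then show ?thesis using that edge_subset[OF assms] by simp
qed

lemma edge_in_V: "connected_graph V E \<Longrightarrow> {a, b} \<in> E \<Longrightarrow> a \<in> V \<and> b \<in> V"
  by (drule (1) edge_subset) simp

section \<open>Cycles as periodic vertex sequences\<close>

text \<open>
  A cycle is traversed by an infinite periodic sequence, so that indices need no wrapping and
  a rotation is just a shift of the index.
\<close>

definition cyc :: "nat \<Rightarrow> (nat \<Rightarrow> 'a) \<Rightarrow> bool" where
  "cyc k x \<longleftrightarrow> 3 \<le> k \<and> (\<forall>i j. x i = x j \<longleftrightarrow> i mod k = j mod k)"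

abbreviation ed :: "(nat \<Rightarrow> 'a) \<Rightarrow> nat \<Rightarrow> 'a set" where
  "ed x i \<equiv> {x i, x (Suc i)}"

lemma cyc_eq_iff: "cyc k x \<Longrightarrow> x i = x j \<longleftrightarrow> i mod k = j mod k"
  by (simp add: cyc_def)

lemma cyc_pos: "cyc k x \<Longrightarrow> 0 < k"
  by (simp add: cyc_def)

lemma add_mod_cancel: "(i + r) mod k = (j + r) mod k \<longleftrightarrow> i mod k = j mod (k :: nat)"
proof -
  have "m mod k = n mod k \<longleftrightarrow> int k dvd int m - int n" for m n
    by (metis mod_eq_dvd_iff of_nat_eq_iff zmod_int)
  then show ?thesis by simp
qed

lemma cyc_shift: "cyc k x \<Longrightarrow> cyc k (\<lambda>i. x (i + r))"
  by (simp add: cyc_def add_mod_cancel)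

text \<open>
  This fails for period 2, where an edge would be traversed back and forth; hence the length bound
  in \<open>cyc\<close>.
\<close>

lemma ed_eq_iff:
  assumes "cyc k x"
  shows "ed x i = ed x j \<longleftrightarrow> i mod k = j mod k"
proof
  assume "ed x i = ed x j"
  then consider "x i = x j" | "x i = x (Suc j)" "x (Suc i) = x j"
    by (auto simp: doubleton_eq_iff)
  then show "i mod k = j mod k"
  proof cases
    case 2
    then have "i mod k = Suc j mod k" "Suc i mod k = j mod k"
      using assms by (auto simp: cyc_eq_iff)
    then have "Suc (Suc i) mod k = i mod k" by (metis mod_Suc_eq)
    moreover have "k \<ge> 3" using assms by (simp add: cyc_def)
    ultimately have False by (simp add: mod_Suc split: if_splits)
    then show ?thesis ..
  qed (use assms in \<open>simp add: cyc_eq_iff\<close>)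
next
  assume "i mod k = j mod k"
  then have "Suc i mod k = Suc j mod k" by (metis mod_Suc_eq)
  with \<open>i mod k = j mod k\<close> show "ed x i = ed x j"
    using assms by (metis cyc_eq_iff)
qed

lemma range_ed:
  assumes "cyc k x"
  shows "range (ed x) = ed x ` {..<k}"
proof -
  have "ed x i = ed x (i mod k)" for i by (subst ed_eq_iff[OF assms]) simp
  moreover have "i mod k < k" for i using assms by (simp add: cyc_def)
  ultimately show ?thesis by blast
qed

lemma range_ed_shift:
  assumes "cyc k x"
  shows "range (ed (\<lambda>i. x (i + r))) = range (ed x)"
proof (intro equalityI image_subsetI)
  fix i
  show "{x (i + r), x (Suc i + r)} \<in> range (ed x)" by (rule range_eqI[of _ _ "i + r"]) simp
  \<comment> \<open>adding a multiple of the period makes it possible to shift back by \<open>r\<close> in the naturals\<close>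
  have "r \<le> r * k" using cyc_pos[OF assms] by simp
  then have "i + r * k - r + r = i + r * k" by linarith
  then have "(i + r * k - r + r) mod k = i mod k" by simp
  then have "ed x (i + r * k - r + r) = ed x i" using ed_eq_iff[OF assms] by blast
  then show "ed x i \<in> range (ed (\<lambda>i. x (i + r)))"
    by (intro range_eqI[of _ _ "i + r * k - r"]) simp
qed

lemma inj_on_ed: "cyc k x \<Longrightarrow> inj_on (ed x) {..<k}"
  by (auto simp: inj_on_def ed_eq_iff)

lemma card_range_ed: "cyc k x \<Longrightarrow> card (range (ed x)) = k"
  by (simp add: range_ed card_image inj_on_ed)

lemma is_cycle_subset: "is_cycle E C \<Longrightarrow> C \<subseteq> F \<Longrightarrow> is_cycle F C"
  by (simp add: is_cycle_def)

lemma cyclic_edges_cycE: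
  assumes "distinct xs" "3 \<le> length xs"
  obtains x where "cyc (length xs) x" "cyclic_edges xs = range (ed x)"
proof -
  define x where "x i = xs ! (i mod length xs)" for i
  have c: "cyc (length xs) x"
    unfolding cyc_def x_def
  proof (intro conjI allI)
    have "i mod length xs < length xs" for i
      using assms(2) by (intro mod_less_divisor) linarith
    then show "(xs ! (i mod length xs) = xs ! (j mod length xs)) =
        (i mod length xs = j mod length xs)" for i j
      using assms(1) by (simp add: nth_eq_iff_index_eq)
  qed (rule assms(2))
  have "cyclic_edges xs = ed x ` {..<length xs}"
    unfolding cyclic_edges_def x_def by (auto simp: image_def)
  then show ?thesis using that c range_ed[OF c] by simp
qed

lemma is_cycle_cycE:
  assumes "is_cycle E C"
  obtains k x where "cyc k x" "C = range (ed x)" "C \<subseteq> E" "card C = k"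
proof -
  obtain xs where xs: "distinct xs" "3 \<le> length xs" "C = cyclic_edges xs" "C \<subseteq> E"
    using assms by (auto simp: is_cycle_def)
  from cyclic_edges_cycE[OF xs(1,2)] obtain x
    where x: "cyc (length xs) x" "cyclic_edges xs = range (ed x)" .
  from that[OF x(1)] show ?thesis using xs x card_range_ed[OF x(1)] by simp
qed

lemma is_cycle_of_length:
  assumes "is_cycle E C" "card C = n"
  obtains x where "cyc n x" "C = range (ed x)" "C \<subseteq> E"
  using is_cycle_cycE[OF assms(1)] assms(2) by metis

lemma card_cycle_ge_3: "is_cycle E C \<Longrightarrow> 3 \<le> card C"
  by (erule is_cycle_cycE) (simp add: cyc_def)

lemma conn_chain:
  assumes "a \<le> b" and "\<And>l. a \<le> l \<Longrightarrow> l < b \<Longrightarrow> ed x l \<in> F"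
  shows "conn F (x a) (x b)"
  using assms
proof (induction rule: dec_induct)
  case (step n)
  then show ?case by (metis conn_edge conn_trans less_SucI lessI)
qed simp

lemma ed_neq:
  assumes "cyc k x" "j < l" "l < j + k"
  shows "ed x l \<noteq> ed x j"
proof
  assume "ed x l = ed x j"
  then have "l mod k = j mod k" using ed_eq_iff[OF assms(1)] by blast
  then have "k dvd l - j" using assms(2) by (simp add: mod_eq_dvd_iff_nat)
  then show False using assms(2,3) by (auto dest: dvd_imp_le)
qed

lemma conn_remove_cycle_edge:
  assumes "is_cycle E C" "e \<in> C" "conn E u v"
  shows "conn (E - {e}) u v"
proof -
  obtain k x where c: "cyc k x" "C = range (ed x)" "C \<subseteq> E"
    using is_cycle_cycE[OF assms(1)] by metis
  obtain i where i: "e = ed x i" using assms(2) c by auto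
  have k: "k \<ge> 3" using c by (simp add: cyc_def)
  have "conn (E - {e}) (x (Suc i)) (x (i + k))"
  proof (rule conn_chain)
    fix l assume l: "Suc i \<le> l" "l < i + k"
    then have "ed x l \<noteq> ed x i" by (intro ed_neq[OF c(1)]) simp_all
    then show "ed x l \<in> E - {e}" using c(2,3) i by auto
  qed (use k in auto)
  moreover have "x (i + k) = x i" using c by (simp add: cyc_eq_iff)
  ultimately have *: "conn (E - {e}) (x (Suc i)) (x i)" by simp
  show ?thesis
    using assms(3)
  proof (rule conn_simulate)
    fix a b assume "{a, b} \<in> E"
    show "conn (E - {e}) a b"
    proof (cases "{a, b} = e")
      case True
      then show ?thesis using * i conn_sym by (auto simp: doubleton_eq_iff)
    qed (use \<open>{a, b} \<in> E\<close> in \<open>auto intro: conn_edge\<close>)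
  qed
qed

lemma connected_remove_cycle_edge:
  assumes "connected_graph V E" "is_cycle E C" "e \<in> C"
  shows "connected_graph V (E - {e})"
  using assms(1)
proof (rule connected_graph_subset)
  show "conn (E - {e}) a b" if "{a, b} \<in> E" for a b
    using conn_remove_cycle_edge[OF assms(2,3)] conn_edge[OF that] by blast
qed blast

lemma conn_distinct_path:
  assumes "conn F u v"
  obtains xs where "distinct xs" "xs \<noteq> []" "hd xs = u" "last xs = v"
    "successively (\<lambda>a b. {a, b} \<in> F) xs"
proof -
  have "\<exists>xs. distinct xs \<and> xs \<noteq> [] \<and> hd xs = u \<and> last xs = v \<and>
      successively (\<lambda>a b. {a, b} \<in> F) xs"
    using assms
  proof (induction rule: conn_induct)
    case refl
    show ?case by (rule exI[of _ "[u]"]) simp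
  next
    case (step a b)
    then obtain xs where xs: "distinct xs" "xs \<noteq> []" "hd xs = u" "last xs = a"
      "successively (\<lambda>a b. {a, b} \<in> F) xs" by blast
    show ?case
    proof (cases "b \<in> set xs")
      case True
      then obtain ys zs where "xs = ys @ b # zs" by (meson split_list)
      then have "xs = (ys @ [b]) @ zs" by simp
      with xs show ?thesis
        by (intro exI[of _ "ys @ [b]"]) (auto simp: successively_append_iff hd_append)
    next
      case False
      with xs \<open>{a, b} \<in> F\<close> show ?thesis
        by (intro exI[of _ "xs @ [b]"]) (auto simp: successively_append_iff)
    qed
  qed
  then show ?thesis using that by blast
qed

text \<open>
  An edge that is not a bridge lies on a cycle: a simple path joining its ends without using it
  is closed up by the edge.
\<close>

lemma cycle_through_edge:
  assumes "{u, v} \<in> E" "u \<noteq> v" "conn (E - {{u, v}}) u v"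
  obtains C where "is_cycle E C" "{u, v} \<in> C"
proof -
  obtain xs where xs: "distinct xs" "xs \<noteq> []" "hd xs = u" "last xs = v"
    "successively (\<lambda>a b. {a, b} \<in> E - {{u, v}}) xs"
    using conn_distinct_path[OF assms(3)] by metis
  define n where "n = length xs"
  have nth: "{xs ! i, xs ! Suc i} \<in> E - {{u, v}}" if "Suc i < n" for i
    using xs(5) that unfolding n_def by (simp add: successively_conv_nth)
  have ends: "xs ! 0 = u" "xs ! (n - 1) = v"
    using xs by (auto simp: hd_conv_nth last_conv_nth n_def)
  \<comment> \<open>a path with two vertices would consist of the excluded edge itself\<close>
  have "n \<noteq> 0" using xs by (simp add: n_def)
  moreover have "n \<noteq> 1" using ends assms(2) by auto
  moreover have "n \<noteq> 2" using ends nth[of 0] by auto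
  ultimately have n: "3 \<le> n" by linarith
  have wrap: "{xs ! (n - 1), xs ! (Suc (n - 1) mod n)} = {u, v}"
    using n ends by (simp add: insert_commute)
  have "cyclic_edges xs \<subseteq> E"
  proof
    fix e assume "e \<in> cyclic_edges xs"
    then obtain i where i: "i < n" "e = {xs ! i, xs ! (Suc i mod n)}"
      by (auto simp: cyclic_edges_def n_def)
    show "e \<in> E"
    proof (cases "Suc i < n")
      case True
      then show ?thesis using i nth[of i] by simp
    next
      case False
      then have "i = n - 1" using i by simp
      then show ?thesis using i wrap assms(1) by simp
    qed
  qed
  moreover have "{u, v} \<in> cyclic_edges xs"
    unfolding cyclic_edges_def n_def[symmetric] using wrap n
    by (intro CollectI exI[of _ "n - 1"]) auto
  ultimately show ?thesis
    using that xs(1) n unfolding is_cycle_def n_def by blast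
qed

section \<open>Rainbow trees and the index\<close>

lemma spanning_tree_exists:
  assumes "connected_graph V E"
  obtains F where "F \<subseteq> E" "is_tree V F"
proof -
  have "\<exists>F\<subseteq>E. is_tree V F"
    using finite_edges[OF assms] assms
  proof (induction E rule: finite_psubset_induct)
    case (psubset E)
    show ?case
    proof (cases "\<exists>C. is_cycle E C")
      case True
      then obtain C where C: "is_cycle E C" by blast
      obtain k x where "C = range (ed x)" "C \<subseteq> E"
        using is_cycle_cycE[OF C] by metis
      then obtain e where e: "e \<in> C" "e \<in> E"
        by blast
      have "connected_graph V (E - {e})"
        using connected_remove_cycle_edge[OF psubset.prems C e(1)] .
      moreover have "E - {e} \<subset> E" using e by blast
      ultimately obtain F where "F \<subseteq> E - {e}" "is_tree V F" using psubset.IH by metis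
      then show ?thesis by blast
    next
      case False
      then have "is_tree V E" using psubset.prems by (simp add: is_tree_def)
      then show ?thesis by blast
    qed
  qed
  then show ?thesis using that by blast
qed

text \<open>
  From right to left, a spanning tree of the component of \<open>S\<close> is a rainbow tree, as subsets of
  rainbow sets are rainbow.
\<close>

lemma has_rainbow_S_tree_iff:
  assumes "connected_graph V E" "S \<subseteq> V" "S \<noteq> {}"
  shows "has_rainbow_S_tree V E c S \<longleftrightarrow> (\<exists>F\<subseteq>E. inj_on c F \<and> links F S)"
proof
  assume "has_rainbow_S_tree V E c S"
  then obtain W F where WF: "rainbow_tree V E c W F" "S \<subseteq> W"
    unfolding has_rainbow_S_tree_def by blast
  then have F: "F \<subseteq> E" "inj_on c F" "links F W"
    by (simp_all add: rainbow_tree_def is_tree_def connected_graph_iff)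
  with WF(2) have "links F S" by (auto simp: links_def)
  with F show "\<exists>F\<subseteq>E. inj_on c F \<and> links F S" by blast
next
  assume "\<exists>F\<subseteq>E. inj_on c F \<and> links F S"
  then obtain F r where F: "F \<subseteq> E" "inj_on c F" "links F S" and r: "r \<in> S"
    using assms(3) by blast
  define W where "W = {v \<in> V. conn F r v}"
  define F' where "F' = {e \<in> F. e \<subseteq> W}"
  have "conn F' r v" if "conn F r v" for v
    using that
  proof (rule conn_simulate)
    fix a b assume ab: "conn F r a" "{a, b} \<in> F"
    then have "conn F r b" by (metis conn_edge conn_trans)
    moreover have "a \<in> V" "b \<in> V" using edge_in_V[OF assms(1)] ab F by auto
    ultimately show "conn F' a b"
      using ab by (auto simp: F'_def W_def intro!: conn_edge)
  qed
  then have "conn F' v r" if "v \<in> W" for v using that conn_sym[of F' r v] by (simp add: W_def)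
  then have "links F' W" by (rule links_from_root)
  moreover have "r \<in> W" using r assms(2) by (auto simp: W_def)
  moreover have "finite W" using finite_vertices[OF assms(1)] by (simp add: W_def)
  moreover have "card e = 2" if "e \<in> F'" for e
    using that card_edge[OF assms(1)] F(1) by (auto simp: F'_def)
  moreover have "e \<subseteq> W" if "e \<in> F'" for e
    using that by (simp add: F'_def)
  ultimately have "connected_graph W F'"
    unfolding connected_graph_iff simple_graph_def by blast
  from spanning_tree_exists[OF this] obtain T where T: "T \<subseteq> F'" "is_tree W T" .
  then have "T \<subseteq> F" by (auto simp: F'_def)
  have "S \<subseteq> W" using F(3) r assms(2) by (auto simp: W_def links_def)
  moreover have "T \<subseteq> E" "W \<subseteq> V" using \<open>T \<subseteq> F\<close> F(1) by (auto simp: W_def)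
  moreover have "inj_on c T" using F(2) \<open>T \<subseteq> F\<close> by (rule inj_on_subset)
  ultimately have "rainbow_tree V E c W T" "S \<subseteq> W"
    using T(2) by (simp_all add: rainbow_tree_def)
  then show "has_rainbow_S_tree V E c S" unfolding has_rainbow_S_tree_def by blast
qed

text \<open>
  Smaller sets can be used in place of the three vertices, since they extend to triples. This spares
  the lower bounds from checking that the chosen vertices are distinct.
\<close>

lemma rainbow3_links:
  assumes "connected_graph V E" "card V \<ge> 3" "rainbow3_coloring V E c"
    and "T \<subseteq> V" "card T \<le> 3"
  obtains F where "F \<subseteq> E" "inj_on c F" "links F T"
proof -
  obtain S where S: "T \<subseteq> S" "S \<subseteq> V" "card S = 3"
    using exists_subset_between[OF assms(5,2,4) finite_vertices[OF assms(1)]] by blast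
  have ne: "S \<noteq> {}" using S(3) by auto
  have "has_rainbow_S_tree V E c S"
    using assms(3) S by (simp add: rainbow3_coloring_def)
  then obtain F where F: "F \<subseteq> E" "inj_on c F" "links F S"
    using has_rainbow_S_tree_iff[OF assms(1) S(2) ne] by blast
  from F(3) S(1) have "links F T" unfolding links_def by blast
  with F show ?thesis using that by blast
qed

text \<open>
  Edges outside \<open>E'\<close> repeat a colour of \<open>E'\<close>, so they cost nothing.
\<close>

lemma rx3_upper:
  fixes c :: "'a set \<Rightarrow> 'c"
  assumes "connected_graph V E" "E' \<subseteq> E" "E' \<noteq> {}"
    and "\<And>S. S \<subseteq> V \<Longrightarrow> card S = 3 \<Longrightarrow> \<exists>F\<subseteq>E'. inj_on c F \<and> links F S"
  shows "\<exists>c' :: 'a set \<Rightarrow> nat. c' ` E \<subseteq> {..<card (c ` E')} \<and> rainbow3_coloring V E c'"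
    and "rx3 V E \<le> card (c ` E')"
proof -
  have "finite (c ` E')" using finite_edges[OF assms(1)] assms(2) finite_subset by blast
  then obtain h where h: "bij_betw h (c ` E') {..<card (c ` E')}"
    using ex_bij_betw_finite_nat unfolding lessThan_atLeast0 by blast
  obtain e0 where e0: "e0 \<in> E'" using assms(3) by blast
  define c' where "c' e = (if e \<in> E' then h (c e) else h (c e0))" for e
  have "h ` c ` E' = {..<card (c ` E')}" using h by (simp add: bij_betw_def)
  then have "c' ` E \<subseteq> {..<card (c ` E')}"
    using e0 unfolding c'_def by (intro image_subsetI) (simp, blast)
  moreover have "rainbow3_coloring V E c'"
    unfolding rainbow3_coloring_def
  proof (intro allI impI, elim conjE)
    fix S assume S: "S \<subseteq> V" "card S = 3"
    then obtain F where F: "F \<subseteq> E'" "inj_on c F" "links F S" using assms(4) by blast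
    have "inj_on h (c ` F)"
      using h F(1) unfolding bij_betw_def by (meson image_mono inj_on_subset)
    then have "inj_on (h \<circ> c) F" using F(2) by (simp add: comp_inj_on)
    moreover have "c' e = (h \<circ> c) e" if "e \<in> F" for e using that F(1) by (auto simp: c'_def)
    ultimately have "inj_on c' F" using inj_on_cong by blast
    moreover have "F \<subseteq> E" "S \<noteq> {}" using F(1) assms(2) S(2) by auto
    ultimately show "has_rainbow_S_tree V E c' S"
      using has_rainbow_S_tree_iff[OF assms(1) S(1)] F(3) by blast
  qed
  ultimately show ex: "\<exists>c' :: 'a set \<Rightarrow> nat.
      c' ` E \<subseteq> {..<card (c ` E')} \<and> rainbow3_coloring V E c'"
    by blast
  then show "rx3 V E \<le> card (c ` E')" unfolding rx3_def by (rule Least_le)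
qed

lemma rx3_le_spanning:
  assumes "connected_graph V E" "E' \<subseteq> E" "E' \<noteq> {}" "connected_graph V E'"
  shows "rx3 V E \<le> card E'"
proof -
  have "\<exists>F\<subseteq>E'. inj_on (\<lambda>e. e) F \<and> links F S" if "S \<subseteq> V" for S
    using assms(4) that by (intro exI[of _ E']) (auto simp: connected_graph_iff links_def)
  from rx3_upper(2)[OF assms(1-3) this] show ?thesis by simp
qed

lemma edges_nonempty:
  assumes "connected_graph V E" "card V \<ge> 3"
  shows "E \<noteq> {}"
proof
  assume E: "E = {}"
  have "u = v" if "u \<in> V" "v \<in> V" for u v
    using connected_graph_conn[OF assms(1) that] conn_invariant[of E u v "\<lambda>w. w = u"] E by auto
  moreover have "\<not> card V \<le> Suc 0" "finite V"
    using assms(2) finite_vertices[OF assms(1)] by auto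
  ultimately show False using card_le_Suc0_iff_eq by metis
qed

lemma rx3_attained:
  fixes V :: "'a set"
  assumes "connected_graph V E" "card V \<ge> 3"
  obtains c :: "'a set \<Rightarrow> nat" where "rainbow3_coloring V E c" "card (c ` E) \<le> rx3 V E"
proof -
  have "\<exists>F\<subseteq>E. inj_on (\<lambda>e. e) F \<and> links F S" if "S \<subseteq> V" for S
    using assms(1) that by (intro exI[of _ E]) (auto simp: connected_graph_iff links_def)
  from rx3_upper(1)[OF assms(1) _ edges_nonempty[OF assms] this]
  have "\<exists>k. \<exists>c' :: 'a set \<Rightarrow> nat. c' ` E \<subseteq> {..<k} \<and> rainbow3_coloring V E c'"
    by blast
  from LeastI_ex[OF this] obtain c :: "'a set \<Rightarrow> nat"
    where c: "c ` E \<subseteq> {..<rx3 V E}" "rainbow3_coloring V E c"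
    unfolding rx3_def by blast
  then have "card (c ` E) \<le> rx3 V E" using card_mono[OF _ c(1)] by simp
  then show ?thesis using that c by blast
qed

section \<open>Bridges\<close>

text \<open>
  If both ends of the bridge had a connection to \<open>R\<close> avoiding it, the bridge would lie on a
  cycle. The end without such a connection is the far end \<open>s\<close>.
\<close>

lemma bridge_forced:
  assumes V: "connected_graph V E" and e: "e \<in> E" "\<And>C. is_cycle E C \<Longrightarrow> e \<notin> C"
    and R: "links (E - {e}) R"
  shows "\<exists>s\<in>V. \<forall>F\<subseteq>E. \<forall>r\<in>R. conn F s r \<longrightarrow> e \<in> F"
proof -
  obtain u v where uv: "e = {u, v}" "u \<noteq> v" "u \<in> V" "v \<in> V"
    using edge_ends[OF V e(1)] .
  have nc: "\<not> conn (E - {e}) u v"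
    using cycle_through_edge[of u v E] uv e by metis
  have "\<exists>s\<in>V. \<forall>r\<in>R. \<not> conn (E - {e}) s r"
  proof (rule ccontr)
    assume "\<not> ?thesis"
    then obtain r r' where "r \<in> R" "conn (E - {e}) u r" "r' \<in> R" "conn (E - {e}) v r'"
      using uv by blast
    moreover from this have "conn (E - {e}) r r'" using R by (simp add: links_def)
    ultimately show False using nc conn_trans conn_sym by metis
  qed
  then obtain s where s: "s \<in> V" "\<And>r. r \<in> R \<Longrightarrow> \<not> conn (E - {e}) s r" by blast
  have "e \<in> F" if "F \<subseteq> E" "r \<in> R" "conn F s r" for F r
  proof (rule ccontr)
    assume "e \<notin> F"
    then have "F \<subseteq> E - {e}" using that(1) by blast
    with conn_mono[OF that(3)] s(2)[OF that(2)] show False by blast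
  qed
  with s(1) show ?thesis by blast
qed

text \<open>
  A rainbow set that links the far ends of two bridges to a common root contains both bridges.
\<close>

lemma bridges_inj_on:
  assumes V: "connected_graph V E" "card V \<ge> 3" and c: "rainbow3_coloring V E c"
    and B: "B \<subseteq> E" "\<And>C. is_cycle E C \<Longrightarrow> B \<inter> C = {}"
  shows "inj_on c B"
proof (rule inj_onI)
  fix e f assume ef: "e \<in> B" "f \<in> B" "c e = c f"
  obtain r where r: "r \<in> V" using V(1) by (auto simp: connected_graph_iff)
  have R: "links F {r}" for F by (simp add: links_def)
  have far: "\<exists>s\<in>V. \<forall>F\<subseteq>E. conn F s r \<longrightarrow> d \<in> F" if d: "d \<in> B" for d
  proof -
    have "d \<in> E" "\<And>C. is_cycle E C \<Longrightarrow> d \<notin> C" using d B by blast+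
    from bridge_forced[OF V(1) this R] show ?thesis by simp
  qed
  obtain s where s: "s \<in> V" "\<And>F. F \<subseteq> E \<Longrightarrow> conn F s r \<Longrightarrow> e \<in> F"
    using far[OF ef(1)] by blast
  obtain t where t: "t \<in> V" "\<And>F. F \<subseteq> E \<Longrightarrow> conn F t r \<Longrightarrow> f \<in> F"
    using far[OF ef(2)] by blast
  have "{s, t, r} \<subseteq> V" "card {s, t, r} \<le> 3" using r s(1) t(1) by (auto simp: card_insert_if)
  from rainbow3_links[OF V c this] obtain F
    where F: "F \<subseteq> E" "inj_on c F" "links F {s, t, r}" .
  then have "conn F s r" "conn F t r" by (simp_all add: links_def)
  then have "e \<in> F" "f \<in> F" using s(2) t(2) F(1) by blast+
  then show "e = f" using F(2) ef(3) by (simp add: inj_on_eq_iff)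
qed

section \<open>Projecting a graph onto one of its cycles\<close>

text \<open>
  The map \<open>p\<close> retracts the graph onto the cycle: it is constant along all other edges and
  sends each cycle vertex to its index.
\<close>

definition cycle_projection :: "'a set set \<Rightarrow> nat \<Rightarrow> (nat \<Rightarrow> 'a) \<Rightarrow> ('a \<Rightarrow> nat) \<Rightarrow> bool" where
  "cycle_projection E k x p \<longleftrightarrow> cyc k x \<and> (\<forall>i<k. p (x i) = i) \<and>
     (\<forall>u v. {u, v} \<in> E - range (ed x) \<longrightarrow> p u = p v)"

lemma projection_mod:
  assumes "cycle_projection E k x p"
  shows "p (x i) = i mod k"
proof -
  have "cyc k x" using assms by (simp add: cycle_projection_def)
  then have "x i = x (i mod k)" "i mod k < k" using cyc_eq_iff[of k x] cyc_pos[of k x] by simp_all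
  then show ?thesis using assms by (simp add: cycle_projection_def)
qed

text \<open>
  Without the edges of index \<open>a\<close> and \<open>b\<close> no step along the cycle enters or leaves the arc formed by
  the indices \<open>a + 1, \<dots>, b\<close>, and the steps off the cycle do not change the index.
\<close>

lemma two_gaps:
  assumes p: "cycle_projection E k x p" and F: "F \<subseteq> E" "ed x a \<notin> F" "ed x b \<notin> F"
    and ab: "a < b" "b < k" and uv: "conn F u v"
  shows "(a < p u \<and> p u \<le> b) = (a < p v \<and> p v \<le> b)"
  using uv
proof (rule conn_invariant)
  fix s t assume st: "{s, t} \<in> F"
  have c: "cyc k x" using p by (simp add: cycle_projection_def)
  show "(a < p s \<and> p s \<le> b) = (a < p t \<and> p t \<le> b)"
  proof (cases "{s, t} \<in> range (ed x)")
    case True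
    then obtain l where l: "l < k" "{s, t} = ed x l" using range_ed[OF c] by auto
    then have "l \<noteq> a" "l \<noteq> b" using st F by auto
    then have "(a < p (x l) \<and> p (x l) \<le> b) = (a < p (x (Suc l)) \<and> p (x (Suc l)) \<le> b)"
      using projection_mod[OF p] l(1) ab by (auto simp: mod_Suc)
    then show ?thesis using l(2) by (auto simp: doubleton_eq_iff)
  next
    case False
    then have "p s = p t" using p st F(1) by (auto simp: cycle_projection_def)
    then show ?thesis by simp
  qed
qed

text \<open>
  Removing an edge of \<open>C\<close> leaves its ends connected inside \<open>C\<close>. If \<open>C\<close> also missed some edge of
  \<open>D\<close>, then these ends would be connected in \<open>D\<close> after removal of two edges, which separates them.
\<close>

lemma cycle_minimal:
  assumes "is_cycle E C" "is_cycle E D" "C \<subseteq> D"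
  shows "C = D"
proof (rule ccontr)
  assume "C \<noteq> D"
  obtain k x where x: "cyc k x" "D = range (ed x)" using is_cycle_cycE[OF assms(2)] by metis
  obtain k' y where y: "cyc k' y" "C = range (ed y)" using is_cycle_cycE[OF assms(1)] by metis
  obtain e where e: "e \<in> C" using y by blast
  obtain f where f: "f \<in> D" "f \<notin> C" using assms(3) \<open>C \<noteq> D\<close> by blast
  have D: "D = ed x ` {..<k}" unfolding x(2) by (rule range_ed[OF x(1)])
  obtain a where a: "a < k" "e = ed x a" using e assms(3) D by blast
  obtain b where b: "b < k" "f = ed x b" using f D by blast
  have inj: "inj_on x {..<k}" using cyc_eq_iff[OF x(1)] by (simp add: inj_on_def)
  \<comment> \<open>the cycle \<open>D\<close>, regarded as a graph of its own, projects onto itself\<close>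
  define p where "p = inv_into {..<k} x"
  have p: "cycle_projection D k x p"
    unfolding cycle_projection_def p_def using x inj by (simp add: inv_into_f_f)
  have "is_cycle C C" using assms(1) by (simp add: is_cycle_def)
  then have conn: "conn (C - {e}) (x a) (x (Suc a))"
    using e a(2) by (intro conn_remove_cycle_edge[OF _ e] conn_edge) simp_all
  have "a \<noteq> b" using a b e f by auto
  have F: "C - {e} \<subseteq> D" "ed x a \<notin> C - {e}" "ed x b \<notin> C - {e}" using assms(3) a b f by auto
  consider "a < b" | "b < a" using \<open>a \<noteq> b\<close> by linarith
  then show False
  proof cases
    case 1
    from two_gaps[OF p F 1 b(1) conn] show False
      using 1 b(1) by (simp add: projection_mod[OF p])
  next
    case 2
    from two_gaps[OF p F(1,3,2) 2 a(1) conn] show False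
      using 2 a(1) by (auto simp: projection_mod[OF p] mod_Suc split: if_splits)
  qed
qed

lemma conn_to_cycle:
  assumes "connected_graph V E" "cyc k x" "range (ed x) \<subseteq> E" "v \<in> V"
  obtains i where "i < k" "conn (E - range (ed x)) v (x i)"
proof -
  have x: "\<exists>i<k. x j = x i" for j
    using cyc_eq_iff[OF assms(2)] cyc_pos[OF assms(2)] by (intro exI[of _ "j mod k"]) simp
  have "x 0 \<in> V" using edge_in_V[OF assms(1), of "x 0" "x 1"] assms(3) by auto
  then have "conn E (x 0) v" by (rule connected_graph_conn[OF assms(1) _ assms(4)])
  then have "\<exists>i<k. conn (E - range (ed x)) v (x i)"
  proof (induction rule: conn_induct)
    case refl
    obtain i where "i < k" "x 0 = x i" using x by blast
    then show ?case by (intro exI[of _ i]) simp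
  next
    case (step a b)
    show ?case
    proof (cases "{a, b} \<in> range (ed x)")
      case True
      then obtain j where "b = x j" by (auto simp: doubleton_eq_iff)
      moreover obtain i where "i < k" "x j = x i" using x by blast
      ultimately show ?thesis by (intro exI[of _ i]) simp
    next
      case False
      then have "conn (E - range (ed x)) b a"
        using \<open>{a, b} \<in> E\<close> by (intro conn_edge) (auto simp: insert_commute)
      then show ?thesis using step conn_trans[of _ b a] by blast
    qed
  qed
  then show ?thesis using that by blast
qed

text \<open>
  A vertex is sent to the cycle vertex that it reaches off the cycle. This is well defined because a
  connection off the cycle between two cycle vertices would close one of the arcs between them to a
  second cycle.
\<close>

lemma projection_exists:
  assumes V: "connected_graph V E" and x: "cyc k x" "range (ed x) \<subseteq> E"
    and unique: "\<And>D. is_cycle E D \<Longrightarrow> D = range (ed x)"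
  obtains p where "cycle_projection E k x p"
proof -
  define C where "C = range (ed x)"
  have no: False if ij: "i < j" "j < k" "conn (E - C) (x i) (x j)" for i j
  proof -
    \<comment> \<open>deleting the edge after \<open>x j\<close> destroys the given cycle, but together with the connection off the
       cycle the arc from \<open>x i\<close> to \<open>x j\<close> still contains one\<close>
    let ?E = "E - {ed x j}"
    have ne: "ed x l \<noteq> ed x j" if "l < j" for l
      using that ij by (simp add: ed_eq_iff[OF x(1)])
    have "conn (E - C) (x j) (x i)" using ij by (simp add: conn_sym)
    then have "conn (?E - {ed x i}) (x j) (x i)"
      by (rule conn_mono) (auto simp: C_def)
    moreover have "conn (?E - {ed x i}) (x (Suc i)) (x j)"
    proof (rule conn_chain)
      fix l assume l: "Suc i \<le> l" "l < j"
      then have "ed x l \<noteq> ed x i" using ij by (simp add: ed_eq_iff[OF x(1)])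
      then show "ed x l \<in> ?E - {ed x i}" using ne[OF l(2)] x(2) by auto
    qed (use ij in auto)
    ultimately have "conn (?E - {ed x i}) (x (Suc i)) (x i)" by (meson conn_trans)
    then have "conn (?E - {ed x i}) (x i) (x (Suc i))" by (rule conn_sym)
    moreover have "ed x i \<in> ?E" using ne[OF ij(1)] x(2) by auto
    moreover have "x i \<noteq> x (Suc i)" using ij by (simp add: cyc_eq_iff[OF x(1)])
    ultimately obtain D where D: "is_cycle ?E D"
      using cycle_through_edge[of "x i" "x (Suc i)" ?E] by blast
    then have "is_cycle E D" "ed x j \<notin> D" by (auto simp: is_cycle_def)
    then show False using unique[of D] by blast
  qed
  define p where "p v = (SOME i. i < k \<and> conn (E - C) v (x i))" for v
  have p: "p v < k \<and> conn (E - C) v (x (p v))" if "v \<in> V" for v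
    unfolding p_def using conn_to_cycle[OF V x that] unfolding C_def by (rule someI_ex) blast
  have eq: "i = j" if "conn (E - C) v (x i)" "conn (E - C) v (x j)" "i < k" "j < k" for v i j
  proof -
    have "conn (E - C) (x i) (x j)" using that(1,2) by (meson conn_sym conn_trans)
    moreover from this have "conn (E - C) (x j) (x i)" by (rule conn_sym)
    ultimately show ?thesis using no[of i j] no[of j i] that(3,4) by (meson linorder_neqE_nat)
  qed
  have "p (x i) = i" if "i < k" for i
  proof -
    have "{x i, x (Suc i)} \<in> E" using x(2) by blast
    then have "x i \<in> V" using edge_in_V[OF V] by blast
    then show ?thesis using eq[of "x i" "p (x i)" i] p[of "x i"] that by simp
  qed
  moreover have "p u = p v" if uv: "{u, v} \<in> E - C" for u v
  proof -
    have "u \<in> V" "v \<in> V" using edge_in_V[OF V, of u v] uv by auto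
    moreover have "conn (E - C) u v" using uv by (rule conn_edge)
    ultimately have "conn (E - C) u (x (p u))" "conn (E - C) u (x (p v))" "p u < k" "p v < k"
      using p[of u] p[of v] conn_trans[of "E - C" u v] by simp_all
    then show ?thesis by (rule eq)
  qed
  ultimately show ?thesis using that x(1) unfolding cycle_projection_def C_def by blast
qed

section \<open>Lower bound for unicyclic graphs\<close>

text \<open>
  If \<open>A\<close> has \<open>d\<close> edges more than colours, take \<open>d\<close> superfluous edges together with one further
  representative of each of their colours. These edges have at most \<open>card X - d\<close> colours, and a rainbow
  set contains at most one edge of each colour.
\<close>

lemma crowded_colours:
  assumes A: "finite A" and d: "card (c ` A) + d \<le> card A"
  shows "\<exists>X\<subseteq>A. card X \<le> 2 * d \<and> (\<forall>N. inj_on c N \<longrightarrow> d \<le> card (X - N))"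
proof -
  obtain R where R: "R \<subseteq> A" "inj_on c R" "c ` A = c ` R"
    using subset_image_inj[THEN iffD1, OF subset_refl[of "c ` A"]] by blast
  have finR: "finite R" using R(1) A by (rule finite_subset)
  have "d \<le> card (A - R)"
    using d card_image[OF R(2)] R(3) card_Diff_subset[OF finR R(1)] by simp
  then obtain Y where Y: "Y \<subseteq> A - R" "card Y = d" "finite Y"
    by (rule obtain_subset_with_card_n)
  define Q where "Q = {r \<in> R. c r \<in> c ` Y}"
  have finQ: "finite Q" using finR by (simp add: Q_def)
  have cQ: "c ` Q = c ` Y"
  proof (intro equalityI image_subsetI)
    fix y assume "y \<in> Y"
    then have "c y \<in> c ` R" using Y(1) unfolding R(3)[symmetric] by (intro imageI) auto
    then obtain r where r: "r \<in> R" "c y = c r" by blast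
    then have "r \<in> Q" using imageI[OF \<open>y \<in> Y\<close>, of c] by (simp add: Q_def)
    then show "c y \<in> c ` Q" unfolding r(2) by (rule imageI)
  qed (simp add: Q_def)
  have "inj_on c Q" using R(2) by (rule inj_on_subset) (auto simp: Q_def)
  then have "card Q = card (c ` Y)" using cQ card_image[of c Q] by simp
  then have Qd: "card Q \<le> d" using card_image_le[OF Y(3), of c] Y(2) by simp
  have disj: "Y \<inter> Q = {}" using Y(1) by (auto simp: Q_def)
  have cX: "card (Y \<union> Q) = d + card Q"
    using card_Un_disjoint[OF Y(3) finQ disj] Y(2) by simp
  have "d \<le> card ((Y \<union> Q) - N)" if N: "inj_on c N" for N
  proof -
    have "inj_on c ((Y \<union> Q) \<inter> N)" using N by (rule inj_on_subset) simp
    then have "card ((Y \<union> Q) \<inter> N) = card (c ` ((Y \<union> Q) \<inter> N))" by (simp add: card_image)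
    also have "\<dots> \<le> card (c ` Q)" using cQ Y(3) by (intro card_mono) auto
    also have "\<dots> \<le> card Q" using finQ by (rule card_image_le)
    finally have "card ((Y \<union> Q) \<inter> N) \<le> card Q" .
    moreover have "card (Y \<union> Q) = card ((Y \<union> Q) \<inter> N) + card ((Y \<union> Q) - N)"
      using Y(3) finQ by (intro card_Int_Diff) simp
    ultimately show ?thesis using cX by linarith
  qed
  moreover have "Y \<union> Q \<subseteq> A" using Y(1) R(1) by (auto simp: Q_def)
  moreover have "card (Y \<union> Q) \<le> 2 * d" using cX Qd by simp
  ultimately show ?thesis by (intro exI[of _ "Y \<union> Q"]) simp
qed

text \<open>
  Cut at the least \<open>j\<close> that leaves at most \<open>n\<close> elements above. One step earlier more than \<open>n\<close>
  elements are left, so fewer than \<open>d\<close> come before. The bound \<open>1 \<le> n\<close> keeps the cut below \<open>k\<close>.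
\<close>

lemma split_index:
  fixes I :: "nat set"
  assumes I: "I \<subseteq> {..<k}" "card I \<le> n + d" and "1 \<le> n" "1 \<le> k"
  obtains j where "j < k" "card (I \<inter> {..<j}) \<le> d" "card (I \<inter> {j..}) \<le> n"
proof -
  let ?P = "\<lambda>j. card (I \<inter> {j..}) \<le> n"
  have fin: "finite I" using I(1) finite_subset by blast
  have "I \<inter> {k - 1..} \<subseteq> {k - 1}" using I(1) by auto
  then have "card (I \<inter> {k - 1..}) \<le> card {k - 1}" by (intro card_mono) simp_all
  then have "card (I \<inter> {k - 1..}) \<le> 1" by simp
  then have P: "?P (k - 1)" using \<open>1 \<le> n\<close> by linarith
  define j where "j = (LEAST j. ?P j)"
  have "?P j" unfolding j_def using P by (rule LeastI)
  have "j \<le> k - 1" unfolding j_def using P by (rule Least_le)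
  then have "j < k" using \<open>1 \<le> k\<close> by linarith
  have "card (I \<inter> {..<j}) \<le> d"
  proof (cases j)
    case (Suc i)
    then have "i < (LEAST j. ?P j)" by (simp flip: j_def)
    then have "\<not> ?P i" by (rule not_less_Least)
    have "card I = card (I \<inter> {..<i}) + card (I - {..<i})"
      using fin by (rule card_Int_Diff)
    moreover have "I - {..<i} = I \<inter> {i..}" by auto
    ultimately have "card (I \<inter> {..<i}) + Suc n \<le> n + d" using \<open>\<not> ?P i\<close> I(2) by simp
    moreover have "I \<inter> {..<j} \<subseteq> insert i (I \<inter> {..<i})" using Suc by auto
    then have step: "card (I \<inter> {..<j}) \<le> card (insert i (I \<inter> {..<i}))"
      using fin by (intro card_mono) simp_all
    have "card (insert i (I \<inter> {..<i})) \<le> Suc (card (I \<inter> {..<i}))"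
      using fin by (simp add: card_insert_if)
    ultimately show ?thesis using step by linarith
  qed simp
  then show ?thesis using that \<open>j < k\<close> \<open>?P j\<close> by blast
qed

lemma split_index_three:
  fixes I :: "nat set"
  assumes I: "I \<subseteq> {..<k}" "card I \<le> 3 * d" and d: "1 \<le> d" and k: "1 \<le> k"
  obtains j l where "j < k" "l < k" "j \<le> l"
    "card (I \<inter> {..<j}) \<le> d" "card (I \<inter> {j..<l}) \<le> d" "card (I \<inter> {l..}) \<le> d"
proof -
  have "card I \<le> 2 * d + d" "1 \<le> 2 * d" using I(2) d by simp_all
  from split_index[OF I(1) this k]
  obtain j where j: "j < k" "card (I \<inter> {..<j}) \<le> d" "card (I \<inter> {j..}) \<le> 2 * d" .
  have "I \<inter> {j..} \<subseteq> {..<k}" "card (I \<inter> {j..}) \<le> d + d" using I j by auto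
  from split_index[OF this d k]
  obtain l where l: "l < k" "card (I \<inter> {j..} \<inter> {..<l}) \<le> d"
      "card (I \<inter> {j..} \<inter> {l..}) \<le> d" .
  show ?thesis
  proof (rule that[of j "max j l"])
    have "I \<inter> {j..<max j l} = I \<inter> {j..} \<inter> {..<l}" by (auto simp: max_def)
    then show "card (I \<inter> {j..<max j l}) \<le> d" using l(2) by simp
    have "I \<inter> {max j l..} = I \<inter> {j..} \<inter> {l..}" by auto
    then show "card (I \<inter> {max j l..}) \<le> d" using l(3) by simp
  qed (use j l in auto)
qed

text \<open>
  Start the cycle at the vertex below \<open>s\<close> and choose \<open>a\<close> and \<open>b\<close> so that each of the three arcs
  contains at most \<open>d\<close> edges of \<open>X\<close>. By \<open>two_gaps\<close>, all edges missed by a set linking \<open>s\<close>, \<open>a\<close> and \<open>b\<close>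
  lie in one arc.
\<close>

lemma three_cuts:
  assumes V: "connected_graph V E" and x: "cyc k x" "range (ed x) \<subseteq> E"
    and unique: "\<And>D. is_cycle E D \<Longrightarrow> D = range (ed x)"
    and s: "s \<in> V" and X: "X \<subseteq> range (ed x)" "card X \<le> 3 * d" and d: "1 \<le> d"
  shows "\<exists>a\<in>range x. \<exists>b\<in>range x. \<forall>F\<subseteq>E. links F {s, a, b} \<longrightarrow> card (X - F) \<le> d"
proof -
  from conn_to_cycle[OF V x s] obtain r where "r < k" and r: "conn (E - range (ed x)) s (x r)" .
  define y where "y i = x (i + r)" for i
  have y: "cyc k y" unfolding y_def using x(1) by (rule cyc_shift)
  have ry: "range (ed y) = range (ed x)" unfolding y_def by (rule range_ed_shift[OF x(1)])
  have "range (ed y) \<subseteq> E" "\<And>D. is_cycle E D \<Longrightarrow> D = range (ed y)"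
    unfolding ry by (rule x(2), rule unique)
  from projection_exists[OF V y this] obtain p where p: "cycle_projection E k y p" .
  have "conn (E - range (ed x)) s (y 0)" using r by (simp add: y_def)
  then have "p s = p (y 0)"
  proof (rule conn_invariant[where P = p])
    show "p a = p b" if "{a, b} \<in> E - range (ed x)" for a b
      using p that unfolding cycle_projection_def ry by blast
  qed
  then have ps: "p s = 0" using projection_mod[OF p, of 0] by simp
  define I where "I = {i. i < k \<and> ed y i \<in> X}"
  have finX: "finite X" using X(1) range_ed[OF x(1)] finite_subset by fastforce
  have inj: "inj_on (ed y) I" using inj_on_ed[OF y] by (rule inj_on_subset) (auto simp: I_def)
  have "card I = card (ed y ` I)" using inj by (simp add: card_image)
  also have "\<dots> \<le> card X" using finX by (rule card_mono) (auto simp: I_def)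
  finally have cardI: "card I \<le> 3 * d" using X(2) by linarith
  have Ik: "I \<subseteq> {..<k}" by (auto simp: I_def)
  have "1 \<le> k" using cyc_pos[OF x(1)] by simp
  from split_index_three[OF Ik cardI d this] obtain j l where jl: "j < k" "l < k" "j \<le> l"
      "card (I \<inter> {..<j}) \<le> d" "card (I \<inter> {j..<l}) \<le> d" "card (I \<inter> {l..}) \<le> d" .
  have "card (X - F) \<le> d" if F: "F \<subseteq> E" "links F {s, y j, y l}" for F
  proof -
    define M where "M = {i \<in> I. ed y i \<notin> F}"
    have finI: "finite I" using Ik finite_subset by blast
    have pj: "p (y j) = j" "p (y l) = l" using projection_mod[OF p] jl by simp_all
    have gap: "\<not> (a < j \<and> j \<le> b)" "\<not> (a < l \<and> l \<le> b)" if ab: "a \<in> M" "b \<in> M" "a < b" for a b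
    proof -
      have "b < k" "ed y a \<notin> F" "ed y b \<notin> F" using ab by (auto simp: M_def I_def)
      note tg = two_gaps[OF p F(1) this(2,3) ab(3) this(1)]
      have "conn F s (y j)" "conn F s (y l)" using F(2) by (simp_all add: links_def)
      from tg[OF this(1)] tg[OF this(2)] show "\<not> (a < j \<and> j \<le> b)" "\<not> (a < l \<and> l \<le> b)"
        using ps pj by simp_all
    qed
    have same: "(a < j) = (b < j) \<and> (a < l) = (b < l)" if "a \<in> M" "b \<in> M" for a b
    proof (cases a b rule: linorder_cases)
      case less
      then show ?thesis using gap[OF that] by linarith
    next
      case greater
      then show ?thesis using gap[OF that(2,1)] by linarith
    qed simp
    have "M \<subseteq> I \<inter> {..<j} \<or> M \<subseteq> I \<inter> {j..<l} \<or> M \<subseteq> I \<inter> {l..}"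
    proof (rule ccontr)
      assume "\<not> ?thesis"
      moreover have "M \<subseteq> I" by (auto simp: M_def)
      ultimately have "\<exists>a\<in>M. \<not> a < j" "\<exists>b\<in>M. \<not> (j \<le> b \<and> b < l)" "\<exists>c\<in>M. \<not> l \<le> c"
        by auto
      then obtain a b c where abc: "a \<in> M" "\<not> a < j" "b \<in> M" "\<not> (j \<le> b \<and> b < l)"
          "c \<in> M" "\<not> l \<le> c"
        by blast
      show False using same[OF abc(1,3)] same[OF abc(3,5)] abc(2,4,6) jl(3) by linarith
    qed
    moreover have "card M \<le> card (I \<inter> A)" if "M \<subseteq> I \<inter> A" for A
      using that finI by (intro card_mono) simp_all
    ultimately have "card M \<le> card (I \<inter> {..<j}) \<or> card M \<le> card (I \<inter> {j..<l}) \<or>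
        card M \<le> card (I \<inter> {l..})"
      by blast
    then have "card M \<le> d" using jl by linarith
    moreover have "X - F \<subseteq> ed y ` M"
    proof
      fix e assume e: "e \<in> X - F"
      then have "e \<in> range (ed y)" using X(1) unfolding ry by blast
      then obtain i where "i < k" "e = ed y i" unfolding range_ed[OF y] by blast
      then show "e \<in> ed y ` M" using e by (intro image_eqI[of _ _ i]) (simp_all add: M_def I_def)
    qed
    then have "card (X - F) \<le> card M"
      using finI by (intro surj_card_le[of M _ "ed y"]) (auto simp: M_def)
    ultimately show ?thesis by linarith
  qed
  moreover have "y j \<in> range x" "y l \<in> range x" by (simp_all add: y_def)
  ultimately show ?thesis by blast
qed

lemma cycle_linked:
  assumes "range (ed x) \<subseteq> F"
  shows "links F (range x)"
proof (rule links_from_root)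
  fix s assume "s \<in> range x"
  then obtain i where i: "s = x i" by blast
  have "conn F (x 0) (x i)" by (rule conn_chain) (use assms in blast)+
  then show "conn F s (x 0)" unfolding i by (rule conn_sym)
qed

lemma cycle_vertices:
  assumes "connected_graph V E" "range (ed x) \<subseteq> E"
  shows "x i \<in> V"
proof -
  have "ed x i \<in> E" using assms(2) by blast
  from edge_in_V[OF assms(1) this] show ?thesis by blast
qed

text \<open>
  The cycle stays connected without the bridge, so one end of the bridge is far from all of its
  vertices at once. The third vertex of the triple can therefore be chosen freely on the cycle.
\<close>

lemma far_end_exists:
  assumes V: "connected_graph V E" and x: "range (ed x) \<subseteq> E"
    and unique: "\<And>D. is_cycle E D \<Longrightarrow> D = range (ed x)"
    and e: "e \<in> E - range (ed x)"
  shows "\<exists>s\<in>V. \<forall>F\<subseteq>E. \<forall>i. conn F s (x i) \<longrightarrow> e \<in> F"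
proof -
  have "range (ed x) \<subseteq> E - {e}" using x e by blast
  then have R: "links (E - {e}) (range x)" by (rule cycle_linked)
  have "e \<in> E" "\<And>C. is_cycle E C \<Longrightarrow> e \<notin> C" using e unique by blast+
  from bridge_forced[OF V this R] show ?thesis by simp
qed

text \<open>
  A rainbow set linking the far end of \<open>e\<close> to \<open>x a\<close> and \<open>x b\<close> contains \<open>e\<close>, so it misses all cycle edges
  with the colour of \<open>e\<close>. Two such edges would separate \<open>x a\<close> from \<open>x b\<close>.
\<close>

lemma shared_edge_unique:
  assumes V: "connected_graph V E" "card V \<ge> 3" and c: "rainbow3_coloring V E c"
    and x: "cyc k x" "range (ed x) \<subseteq> E"
    and unique: "\<And>D. is_cycle E D \<Longrightarrow> D = range (ed x)"
    and e: "e \<in> E - range (ed x)"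
    and ab: "a < b" "b < k" "c (ed x a) = c e"
  shows "c (ed x b) \<noteq> c e"
proof
  assume cb: "c (ed x b) = c e"
  from far_end_exists[OF V(1) x(2) unique e]
  obtain s where s: "s \<in> V" "\<forall>F\<subseteq>E. \<forall>i. conn F s (x i) \<longrightarrow> e \<in> F" by (rule bexE)
  from projection_exists[OF V(1) x unique] obtain p where p: "cycle_projection E k x p" .
  have "{s, x a, x b} \<subseteq> V" using s(1) cycle_vertices[OF V(1) x(2)] by simp
  moreover have "card {s, x a, x b} \<le> 3" by (simp add: card_insert_if)
  ultimately obtain F where F: "F \<subseteq> E" "inj_on c F" "links F {s, x a, x b}"
    by (rule rainbow3_links[OF V c])
  have conn: "conn F s (x a)" "conn F (x a) (x b)" using F(3) by (simp_all add: links_def)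
  have eF: "e \<in> F" using s(2)[rule_format, OF F(1) conn(1)] .
  have "ed x i \<notin> F" if "c (ed x i) = c e" for i
  proof
    assume "ed x i \<in> F"
    from inj_onD[OF F(2) that this eF] show False using e by auto
  qed
  from two_gaps[OF p F(1) this[OF ab(3)] this[OF cb] ab(1,2) conn(2)]
  show False using ab by (simp add: projection_mod[OF p])
qed

text \<open>
  A rainbow set linking the far ends \<open>s\<close> and \<open>t\<close> to any cycle vertex misses both cycle edges, so \<open>s\<close>
  projects to the same arc between them as that vertex. But cycle vertices exist in both arcs.
\<close>

lemma shared_bridge_unique:
  assumes V: "connected_graph V E" "card V \<ge> 3" and c: "rainbow3_coloring V E c"
    and x: "cyc k x" "range (ed x) \<subseteq> E"
    and unique: "\<And>D. is_cycle E D \<Longrightarrow> D = range (ed x)"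
    and e: "e \<in> E - range (ed x)" and f: "f \<in> E - range (ed x)"
    and ab: "a < b" "b < k"
  shows "\<not> (c (ed x a) = c e \<and> c (ed x b) = c f)"
proof
  assume clash: "c (ed x a) = c e \<and> c (ed x b) = c f"
  from far_end_exists[OF V(1) x(2) unique e]
  obtain s where s: "s \<in> V" "\<forall>F\<subseteq>E. \<forall>i. conn F s (x i) \<longrightarrow> e \<in> F" by (rule bexE)
  from far_end_exists[OF V(1) x(2) unique f]
  obtain t where t: "t \<in> V" "\<forall>F\<subseteq>E. \<forall>i. conn F t (x i) \<longrightarrow> f \<in> F" by (rule bexE)
  from projection_exists[OF V(1) x unique] obtain p where p: "cycle_projection E k x p" .
  have side: "(a < p s \<and> p s \<le> b) = (a < p (x i) \<and> p (x i) \<le> b)" for i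
  proof -
    have "{s, t, x i} \<subseteq> V" using s(1) t(1) cycle_vertices[OF V(1) x(2)] by simp
    moreover have "card {s, t, x i} \<le> 3" by (simp add: card_insert_if)
    ultimately obtain F where F: "F \<subseteq> E" "inj_on c F" "links F {s, t, x i}"
      by (rule rainbow3_links[OF V c])
    have conn: "conn F s (x i)" "conn F t (x i)" using F(3) by (simp_all add: links_def)
    have eF: "e \<in> F" "f \<in> F"
      using s(2)[rule_format, OF F(1) conn(1)] t(2)[rule_format, OF F(1) conn(2)] .
    have "ed x a \<noteq> e" "ed x b \<noteq> f" using e f by auto
    then have "ed x a \<notin> F" "ed x b \<notin> F"
      using inj_onD[OF F(2), of "ed x a" e] inj_onD[OF F(2), of "ed x b" f] clash eF by auto
    from two_gaps[OF p F(1) this ab conn(1)] show ?thesis .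
  qed
  from side[of a] side[of b] show False using ab by (simp add: projection_mod[OF p])
qed

text \<open>
  The condition on \<open>d\<close> makes the set \<open>X\<close> of \<open>crowded_colours\<close> fit into the bound \<open>3 * d\<close> of
  \<open>three_cuts\<close>: it has at most \<open>2 * (d + 1)\<close> elements, and at most \<open>3\<close> if the cycle is a triangle.
\<close>

lemma unicyclic_lower_bound:
  assumes V: "connected_graph V E" "card V \<ge> 3" and c: "rainbow3_coloring V E c"
    and x: "cyc k x" "range (ed x) \<subseteq> E"
    and unique: "\<And>D. is_cycle E D \<Longrightarrow> D = range (ed x)"
    and d: "1 \<le> d" "k = 3 \<or> 2 \<le> d"
  shows "card E \<le> card (c ` E) + d"
proof (rule ccontr)
  assume few: "\<not> ?thesis"
  define C where "C = range (ed x)"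
  define B where "B = E - C"
  have finE: "finite E" using finite_edges[OF V(1)] .
  have CE: "C \<subseteq> E" using x(2) by (simp add: C_def)
  then have fin: "finite C" "finite B" using finE finite_subset by (auto simp: B_def)
  have Ck: "C = ed x ` {..<k}" unfolding C_def by (rule range_ed[OF x(1)])
  have cardC: "card C = k" unfolding C_def by (rule card_range_ed[OF x(1)])
  have cardE: "card E = card B + card C"
    unfolding B_def using CE finE by (simp add: card_Diff_subset card_mono fin(1))
  have "inj_on c B"
    using CE unique by (intro bridges_inj_on[OF V c]) (auto simp: B_def C_def)
  then have cardB: "card (c ` B) = card B" by (rule card_image)
  have cE: "c ` E = c ` B \<union> c ` C" using CE by (auto simp: B_def)
  have cut: "\<exists>F\<subseteq>E. inj_on c F \<and> card (X - F) \<le> d \<and> (\<exists>i. conn F s (x i))"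
    if "s \<in> V" "X \<subseteq> C" "card X \<le> 3 * d" for s X
  proof -
    from three_cuts[OF V(1) x unique that(1) that(2)[unfolded C_def] that(3) d(1)]
    obtain u v where uv: "u \<in> range x" "v \<in> range x"
      "\<And>F. F \<subseteq> E \<Longrightarrow> links F {s, u, v} \<Longrightarrow> card (X - F) \<le> d" by blast
    have "{s, u, v} \<subseteq> V" using uv that(1) cycle_vertices[OF V(1) x(2)] by auto
    moreover have "card {s, u, v} \<le> 3" by (simp add: card_insert_if)
    ultimately obtain F where F: "F \<subseteq> E" "inj_on c F" "links F {s, u, v}"
      by (rule rainbow3_links[OF V c])
    obtain i where i: "u = x i" using uv(1) by blast
    have "conn F s (x i)" using F(3) by (simp add: links_def i)
    then show ?thesis using F uv(3)[OF F(1,3)] by blast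
  qed
  show False
  proof (cases "c ` B \<inter> c ` C = {}")
    case True
    have "card (c ` E) = card B + card (c ` C)"
      unfolding cE using fin True cardB by (simp add: card_Un_disjoint)
    then have "card (c ` C) + Suc d \<le> card C" using few cardE by linarith
    from crowded_colours[OF fin(1) this] obtain X where
      X: "X \<subseteq> C" "card X \<le> 2 * Suc d" "\<And>N. inj_on c N \<Longrightarrow> Suc d \<le> card (X - N)" by blast
    have "card X \<le> k" using card_mono[OF fin(1) X(1)] cardC by simp
    then have "card X \<le> 3 * d" using X(2) d by auto
    from cut[OF cycle_vertices[OF V(1) x(2)] X(1) this] obtain F
      where "inj_on c F" "card (X - F) \<le> d" by blast
    then show False using X(3)[of F] by linarith
  next
    case False
    then obtain e a where "e \<in> B" "a < k" and "c e = c (ed x a)" unfolding Ck by auto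
    then have e: "e \<in> B" "a < k" "c (ed x a) = c e" by simp_all
    have eE: "e \<in> E - range (ed x)" using e(1) by (simp add: B_def C_def)
    define y where "y = ed x a"
    have y: "y \<in> C" "c y = c e" using e by (simp_all add: y_def C_def)
    have one: "b = a" if "b < k" "c (ed x b) = c e" for b
      using shared_edge_unique[OF V c x unique eE, of a b]
        shared_edge_unique[OF V c x unique eE, of b a] that e(2,3)
      by (meson linorder_neqE_nat)
    have "c ` B \<inter> c ` C \<subseteq> {c e}"
    proof
      fix z assume "z \<in> c ` B \<inter> c ` C"
      then obtain f b where "f \<in> B" "b < k" "z = c f" "z = c (ed x b)"
        unfolding Ck by auto
      then have f: "f \<in> B" "b < k" "z = c f" "c (ed x b) = c f" by simp_all
      have fE: "f \<in> E - range (ed x)" using f(1) by (simp add: B_def C_def)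
      have "b = a"
        using shared_bridge_unique[OF V c x unique eE fE, of a b]
          shared_bridge_unique[OF V c x unique fE eE, of b a] f e(2,3)
        by (meson linorder_neqE_nat)
      then show "z \<in> {c e}" using f e(3) by simp
    qed
    then have "card (c ` B \<inter> c ` C) \<le> 1" using card_mono[of "{c e}"] by fastforce
    then have count: "card B + card (c ` C) \<le> card (c ` E) + 1"
      unfolding cE using card_Un_Int[of "c ` B" "c ` C"] fin cardB by simp
    have "c y \<notin> c ` (C - {y})"
    proof
      assume "c y \<in> c ` (C - {y})"
      then obtain z where z: "c y = c z" "z \<in> C - {y}" by (rule imageE)
      then have "z \<in> ed x ` {..<k}" using Ck by simp
      then obtain b where "b < k" "z = ed x b" by blast
      then show False using one[of b] z y(2) by (simp add: y_def)
    qed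
    then have "card (insert (c y) (c ` (C - {y}))) = Suc (card (c ` (C - {y})))"
      using fin(1) by simp
    moreover have "insert (c y) (c ` (C - {y})) = c ` C"
      using y(1) by (simp add: insert_absorb flip: image_insert)
    ultimately have "card (c ` C) = Suc (card (c ` (C - {y})))" by simp
    moreover have "card C = Suc (card (C - {y}))"
      by (rule card.remove[OF fin(1) y(1)])
    ultimately have "card (c ` (C - {y})) + d \<le> card (C - {y})"
      using few cardE count by linarith
    from crowded_colours[OF finite_Diff[OF fin(1)] this] obtain X where
      "X \<subseteq> C - {y} \<and> card X \<le> 2 * d \<and> (\<forall>N. inj_on c N \<longrightarrow> d \<le> card (X - N))" by (rule exE)
    then have X: "X \<subseteq> C - {y}" "card X \<le> 2 * d" "\<And>N. inj_on c N \<Longrightarrow> d \<le> card (X - N)"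
      by simp_all
    have finX: "finite X" using X(1) fin(1) finite_subset by blast
    \<comment> \<open>the far end of \<open>e\<close> forces \<open>y\<close> to be missed, on top of the \<open>d\<close> missed edges of \<open>X\<close>\<close>
    have yX: "insert y X \<subseteq> C" using X(1) y(1) by blast
    have cyX: "card (insert y X) \<le> 3 * d" using X(2) finX d(1) by (simp add: card_insert_if)
    from far_end_exists[OF V(1) x(2) unique eE]
    obtain s where s: "s \<in> V" "\<forall>F\<subseteq>E. \<forall>i. conn F s (x i) \<longrightarrow> e \<in> F" by (rule bexE)
    from cut[OF s(1) yX cyX] obtain F i
      where F: "F \<subseteq> E" "inj_on c F" "card (insert y X - F) \<le> d" "conn F s (x i)" by blast
    have "e \<in> F" using s(2)[rule_format, OF F(1,4)] .
    moreover have "y \<noteq> e" using y(1) e(1) by (auto simp: B_def)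
    ultimately have "y \<notin> F" using inj_onD[OF F(2) y(2)] by blast
    then have "insert y X - F = insert y (X - F)" by (simp add: insert_Diff_if)
    moreover have "y \<notin> X - F" using X(1) by blast
    ultimately have "card (insert y X - F) = Suc (card (X - F))" using finX by simp
    then show False using F(3) X(3)[OF F(2)] by linarith
  qed
qed

section \<open>Saving colours along cycles\<close>

lemma rx3_remove_cycle_edge:
  assumes V: "connected_graph V E" "card V \<ge> 3" and C: "is_cycle E C"
  shows "rx3 V E + 1 \<le> card E"
proof -
  from is_cycle_cycE[OF C] obtain k x where "C = range (ed x)" "C \<subseteq> E" .
  then obtain e where e: "e \<in> C" "e \<in> E" by blast
  have V': "connected_graph V (E - {e})" by (rule connected_remove_cycle_edge[OF V(1) C e(1)])
  have "rx3 V E \<le> card (E - {e})"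
    using edges_nonempty[OF V' V(2)] by (intro rx3_le_spanning[OF V(1) _ _ V']) blast
  moreover have "card E = Suc (card (E - {e}))"
    by (rule card.remove[OF finite_edges[OF V(1)] e(2)])
  ultimately show ?thesis by linarith
qed

text \<open>
  Colour the first four cycle edges \<open>1, 2, 1, 2\<close> and all other edges differently. Each of the three
  vertices reaches the cycle off the cycle. If one of the inner vertices \<open>x 1\<close>, \<open>x 2\<close>, \<open>x 3\<close> of the
  coloured stretch is not reached, removing its two cycle edges leaves a rainbow set, and the
  remaining cycle edges form a path through all other cycle vertices. Otherwise exactly these three
  are reached, and they are linked by the edges between them.
\<close>

lemma rx3_long_cycle:
  assumes V: "connected_graph V E" and E': "E' \<subseteq> E" "connected_graph V E'"
    and x: "cyc k x" "range (ed x) \<subseteq> E'" and k: "4 \<le> k"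
  shows "rx3 V E + 2 \<le> card E'"
proof -
  define c where "c e = (if e = ed x 2 then ed x 0 else if e = ed x 3 then ed x 1 else e)" for e
  have ne: "ed x l \<noteq> ed x j" if "j < l" "l < j + k" for j l
    by (rule ed_neq[OF x(1) that])
  have distinct: "ed x 0 \<noteq> ed x 1" "ed x 0 \<noteq> ed x 2" "ed x 0 \<noteq> ed x 3"
    "ed x 1 \<noteq> ed x 2" "ed x 1 \<noteq> ed x 3" "ed x 2 \<noteq> ed x 3"
    by (rule ne[symmetric]; use k in linarith)+
  have inE: "ed x i \<in> E'" for i using x(2) by blast
  have finE: "finite E'" by (rule finite_edges[OF E'(2)])
  have inj: "inj_on c F" if "ed x 0 \<notin> F \<or> ed x 2 \<notin> F" "ed x 1 \<notin> F \<or> ed x 3 \<notin> F" for F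
    by (rule inj_onI) (use that distinct in \<open>unfold c_def, metis\<close>)
  have "\<exists>F\<subseteq>E'. inj_on c F \<and> links F S" if S: "S \<subseteq> V" "card S = 3" for S
  proof -
    have "\<exists>i. i < k \<and> conn (E' - range (ed x)) s (x i)" if "s \<in> S" for s
    proof -
      have "s \<in> V" using that S(1) by blast
      from conn_to_cycle[OF E'(2) x this] show ?thesis by blast
    qed
    then obtain q where q: "\<And>s. s \<in> S \<Longrightarrow> q s < k"
      "\<And>s. s \<in> S \<Longrightarrow> conn (E' - range (ed x)) s (x (q s))" by metis
    have attach: "conn (E' - {ed x i, ed x j}) s (x r)"
      if "s \<in> S" "conn (E' - {ed x i, ed x j}) (x r) (x (q s))" for s i j r
    proof -
      have "conn (E' - {ed x i, ed x j}) s (x (q s))"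
        by (rule conn_mono[OF q(2)[OF that(1)]]) auto
      then show ?thesis using conn_sym[OF that(2)] by (rule conn_trans)
    qed
    show ?thesis
    proof (cases "\<exists>u<3. Suc u \<notin> q ` S")
      case True
      then obtain u where u: "u < 3" "Suc u \<notin> q ` S" by blast
      let ?F = "E' - {ed x u, ed x (Suc u)}"
      have chain: "conn ?F (x (u + 2)) (x b)" if "u + 2 \<le> b" "b \<le> u + k" for b
        using that(1)
      proof (rule conn_chain)
        fix l assume l: "u + 2 \<le> l" "l < b"
        then have "ed x l \<noteq> ed x u" "ed x l \<noteq> ed x (Suc u)"
          using that(2) by (intro ne; linarith)+
        then show "ed x l \<in> ?F" using inE by blast
      qed
      have "conn ?F s (x (u + 2))" if s: "s \<in> S" for s
      proof -
        have "q s \<noteq> Suc u" using u(2) imageI[OF s, of q] by auto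
        then consider "u + 2 \<le> q s" | "q s \<le> u" by linarith
        then have "conn ?F (x (u + 2)) (x (q s))"
        proof cases
          case 1
          then show ?thesis using q(1)[OF s] by (intro chain) linarith+
        next
          case 2
          then have "conn ?F (x (u + 2)) (x (q s + k))"
            using u(1) k by (intro chain) linarith+
          moreover have "x (q s + k) = x (q s)" by (simp add: cyc_eq_iff[OF x(1)])
          ultimately show ?thesis by simp
        qed
        with s show ?thesis by (rule attach)
      qed
      then have "links ?F S" by (rule links_from_root)
      moreover have "inj_on c ?F"
      proof (rule inj)
        have "u = 0 \<or> u = 1 \<or> u = 2" using u(1) by linarith
        then show "ed x 0 \<notin> ?F \<or> ed x 2 \<notin> ?F" "ed x 1 \<notin> ?F \<or> ed x 3 \<notin> ?F"
          by (auto simp: numeral_2_eq_2 numeral_3_eq_3)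
      qed
      ultimately show ?thesis by blast
    next
      case False
      let ?F = "E' - {ed x 0, ed x 3}"
      have finS: "finite S" using S(2) card.infinite by fastforce
      have sub: "Suc ` {..<3} \<subseteq> q ` S" using False by auto
      have "card (q ` S) \<le> card (Suc ` {..<3})"
        using card_image_le[OF finS, of q] S(2) by (simp add: card_image)
      then have qS: "q ` S = Suc ` {..<3}"
        using card_seteq[OF finite_imageI[OF finS] sub] by simp
      have chain: "conn ?F (x 1) (x b)" if "1 \<le> b" "b \<le> 3" for b
        using that(1)
      proof (rule conn_chain)
        fix l assume l: "1 \<le> l" "l < b"
        then have "ed x l \<noteq> ed x 0" "ed x 3 \<noteq> ed x l"
          using that(2) k by (intro ne; linarith)+
        then show "ed x l \<in> ?F" using inE by simp
      qed
      have "conn ?F s (x 1)" if s: "s \<in> S" for s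
      proof -
        have "q s \<in> Suc ` {..<3}" using qS s by blast
        then have "1 \<le> q s" "q s \<le> 3" by auto
        then have "conn ?F (x 1) (x (q s))" by (rule chain)
        with s show ?thesis by (rule attach)
      qed
      then have "links ?F S" by (rule links_from_root)
      moreover have "inj_on c ?F" by (rule inj) simp_all
      ultimately show ?thesis by blast
    qed
  qed
  moreover have "E' \<noteq> {}" using inE by blast
  ultimately have "rx3 V E \<le> card (c ` E')" using rx3_upper(2)[OF V E'(1)] by blast
  also have "c ` E' \<subseteq> E' - {ed x 2, ed x 3}"
  proof (rule image_subsetI)
    fix e assume "e \<in> E'"
    then show "c e \<in> E' - {ed x 2, ed x 3}"
      using inE[of 0] inE[of 1] distinct by (simp add: c_def)
  qed
  then have "card (c ` E') \<le> card (E' - {ed x 2, ed x 3})"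
    using finE by (intro card_mono) simp_all
  also have "card (E' - {ed x 2, ed x 3}) = card E' - 2"
    using inE[of 2] inE[of 3] distinct(6) finE by (subst card_Diff_subset) simp_all
  finally have "rx3 V E \<le> card E' - 2" .
  moreover have "card {ed x 2, ed x 3} \<le> card E'"
    using inE[of 2] inE[of 3] finE by (intro card_mono) simp_all
  then have "2 \<le> card E'" using distinct(6) by simp
  ultimately show ?thesis by linarith
qed

text \<open>
  The bypass replaces the first edge, and then the rest of the cycle replaces the second.
\<close>

lemma connected_remove_bypassed_edges:
  assumes V: "connected_graph V E" and x: "cyc k x" "range (ed x) \<subseteq> E"
    and bypass: "conn (E - range (ed x)) (x i) (x (Suc i))"
  shows "connected_graph V (E - {ed x i, ed x (Suc i)})"
proof -
  let ?F = "E - {ed x i, ed x (Suc i)}"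
  have 1: "conn ?F (x i) (x (Suc i))" by (rule conn_mono[OF bypass]) auto
  have "conn ?F (x (i + 2)) (x (i + k))"
  proof (rule conn_chain)
    show "i + 2 \<le> i + k" using x(1) by (simp add: cyc_def)
    fix l assume l: "i + 2 \<le> l" "l < i + k"
    have "ed x l \<noteq> ed x i" "ed x l \<noteq> ed x (Suc i)" by (rule ed_neq[OF x(1)]; use l in linarith)+
    then show "ed x l \<in> ?F" using x(2) by blast
  qed
  moreover have "x (i + k) = x i" by (simp add: cyc_eq_iff[OF x(1)])
  ultimately have "conn ?F (x (Suc (Suc i))) (x i)" by simp
  then have "conn ?F (x (Suc (Suc i))) (x (Suc i))" using 1 by (rule conn_trans)
  then have 2: "conn ?F (x (Suc i)) (x (Suc (Suc i)))" by (rule conn_sym)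
  show ?thesis
    using V
  proof (rule connected_graph_subset)
    fix a b assume ab: "{a, b} \<in> E"
    show "conn ?F a b"
    proof (cases "{a, b} \<in> ?F")
      case False
      then have "{a, b} = ed x i \<or> {a, b} = ed x (Suc i)" using ab by simp
      then show ?thesis
        using 1 2 conn_sym[OF 1] conn_sym[OF 2] by (auto simp: doubleton_eq_iff)
    qed (rule conn_edge)
  qed blast
qed

lemma rx3_bypassed_cycle:
  assumes V: "connected_graph V E" "card V \<ge> 3" and x: "cyc k x" "range (ed x) \<subseteq> E"
    and D: "is_cycle E D" "range (ed x) \<inter> D = {}"
    and bypass: "conn (E - range (ed x)) (x i) (x (Suc i))"
  shows "rx3 V E + 3 \<le> card E"
proof -
  let ?F = "E - {ed x i, ed x (Suc i)}"
  have V': "connected_graph V ?F" by (rule connected_remove_bypassed_edges[OF V(1) x bypass])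
  have "D \<subseteq> ?F" using D by (auto simp: is_cycle_def)
  then have D': "is_cycle ?F D" using D(1) by (simp add: is_cycle_def)
  from is_cycle_cycE[OF D'] obtain l y where "D = range (ed y)" .
  then obtain e where e: "e \<in> D" by blast
  have V'': "connected_graph V (?F - {e})" by (rule connected_remove_cycle_edge[OF V' D' e])
  have ne: "?F - {e} \<noteq> {}" by (rule edges_nonempty[OF V'' V(2)])
  have "rx3 V E \<le> card (?F - {e})" by (rule rx3_le_spanning[OF V(1) _ ne V'']) blast
  moreover have "?F - {e} = E - {ed x i, ed x (Suc i), e}" by auto
  moreover have "ed x (Suc i) \<noteq> ed x i"
    using x(1) by (intro ed_neq[OF x(1)]) (simp_all add: cyc_def)
  moreover have "ed x i \<noteq> e" "ed x (Suc i) \<noteq> e" using D(2) e by auto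
  then have "card {ed x i, ed x (Suc i), e} = 3"
    using \<open>ed x (Suc i) \<noteq> ed x i\<close>[symmetric] by simp
  moreover have sub: "{ed x i, ed x (Suc i), e} \<subseteq> E" using x(2) e \<open>D \<subseteq> ?F\<close> by blast
  moreover have "card {ed x i, ed x (Suc i), e} \<le> card E"
    by (rule card_mono[OF finite_edges[OF V(1)] sub])
  ultimately show ?thesis by (simp add: card_Diff_subset)
qed

text \<open>
  A vertex outside the branch at the corner \<open>x i\<close> needs only the triangle edge opposite to that
  corner. An edge of a further cycle can be spared in addition.
\<close>

lemma triangle_avoid_corner:
  assumes V: "connected_graph V E" and x: "cyc 3 x" "range (ed x) \<subseteq> E"
    and i: "i = 1 \<or> i = 2" and v: "v \<in> V" "\<not> conn (E - range (ed x)) v (x i)"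
    and D: "is_cycle (E - range (ed x)) D" "g \<in> D"
  shows "conn (E - {ed x i, ed x (i + 2), g}) v (x 0)"
proof -
  let ?F = "E - {ed x i, ed x (i + 2)}"
  have F: "E - range (ed x) \<subseteq> ?F" by blast
  from conn_to_cycle[OF V x v(1)] obtain j
    where j: "j < 3" "conn (E - range (ed x)) v (x j)" .
  have per: "x (b + 3) = x b" for b by (simp add: cyc_eq_iff[OF x(1)])
  have "conn ?F (x j) (x 0)"
  proof (cases "j = 0")
    case False
    have "j \<noteq> i" using j(2) v(2) by auto
    then have ij: "i = 1 \<and> j = 2 \<or> i = 2 \<and> j = 1" using i j(1) False by linarith
    have "ed x (i + 1) \<noteq> ed x i" "ed x (i + 2) \<noteq> ed x (i + 1)"
      by (rule ed_neq[OF x(1)]; simp)+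
    then have "ed x (i + 1) \<in> ?F" using x(2) by auto
    then have edge: "conn ?F (x (i + 1)) (x (Suc (i + 1)))" by (rule conn_edge)
    from ij show ?thesis
    proof
      assume "i = 1 \<and> j = 2"
      then show ?thesis using edge per[of 0] by (simp add: numeral_2_eq_2 numeral_3_eq_3)
    next
      assume "i = 2 \<and> j = 1"
      then show ?thesis using conn_sym[OF edge] per[of 0] per[of 1]
        by (simp add: numeral_2_eq_2 numeral_3_eq_3)
    qed
  qed simp
  with conn_mono[OF j(2) F] have "conn ?F v (x 0)" by (rule conn_trans)
  moreover have "is_cycle ?F D" using D(1) F unfolding is_cycle_def by blast
  ultimately have "conn (?F - {g}) v (x 0)" using D(2) by (intro conn_remove_cycle_edge)
  moreover have "?F - {g} = E - {ed x i, ed x (i + 2), g}" by blast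
  ultimately show ?thesis by simp
qed

text \<open>
  The component of \<open>u\<close> in \<open>E - X\<close> does not contain \<open>a\<close>, hence no vertex of the cycle \<open>y\<close> either, so
  connections inside it do not use that cycle.
\<close>

lemma branches_disjoint:
  assumes P: "cyc k y" "range (ed y) \<subseteq> E" and ay: "\<And>j. conn (E - X) (y j) a"
    and na: "\<not> conn (E - X) u a" and uv: "conn (E - X) u v"
  shows "conn (E - range (ed y)) u v"
  using uv
proof (rule conn_simulate)
  fix b d assume bd: "conn (E - X) u b" "{b, d} \<in> E - X"
  have "{b, d} \<notin> range (ed y)"
  proof
    assume "{b, d} \<in> range (ed y)"
    then obtain j where "b = y j" by (auto simp: doubleton_eq_iff)
    then have "conn (E - X) u a" using conn_trans[OF bd(1)] ay by blast
    then show False using na by blast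
  qed
  then show "conn (E - range (ed y)) b d" using bd(2) by (intro conn_edge) blast
qed

text \<open>
  The corner \<open>x 0\<close> is the one where the triangle \<open>y\<close> is attached, and conversely. Corresponding edges
  of the two triangles get the same colour, all other colours are distinct. The branches at \<open>x 1\<close>, \<open>x 2\<close>,
  \<open>y 1\<close> and \<open>y 2\<close> are pairwise disjoint, so three vertices miss one of them. Dropping the corner of a
  missed branch frees two colours of its triangle for the other triangle, which then gives up only
  the edge with the third colour.
\<close>

lemma rx3_two_triangles_based:
  assumes V: "connected_graph V E" and x: "cyc 3 x" "is_cycle E (range (ed x))"
    and y: "cyc 3 y" "is_cycle E (range (ed y))"
    and disj: "range (ed x) \<inter> range (ed y) = {}"
    and off_x: "\<And>i. \<not> conn (E - range (ed x)) (x i) (x (Suc i))"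
    and off_y: "\<And>i. \<not> conn (E - range (ed y)) (y i) (y (Suc i))"
    and ay: "\<And>j. conn (E - range (ed x)) (y j) (x 0)"
    and ax: "\<And>i. conn (E - range (ed y)) (x i) (y 0)"
  shows "rx3 V E + 3 \<le> card E"
proof -
  let ?X = "range (ed x)" and ?Y = "range (ed y)"
  have sub: "?X \<subseteq> E" "?Y \<subseteq> E" using x(2) y(2) by (simp_all add: is_cycle_def)
  have cyc: "is_cycle (E - ?X) ?Y" "is_cycle (E - ?Y) ?X"
    using sub disj by (intro is_cycle_subset[OF y(2)] is_cycle_subset[OF x(2)]; blast)+
  define f where "f i = ed x i" for i
  define g where "g i = ed y i" for i
  have fX: "f i \<in> ?X" and gY: "g i \<in> ?Y" for i unfolding f_def g_def by (rule rangeI)+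
  have fE: "f i \<in> E" and gE: "g i \<in> E" for i using fX gY sub by blast+
  define c where "c e = (if e = g 0 then f 0 else if e = g 1 then f 1
    else if e = g 2 then f 2 else e)" for e
  have nx: "f 1 \<noteq> f 0" "f 2 \<noteq> f 0" "f 2 \<noteq> f 1"
    unfolding f_def by (rule ed_neq[OF x(1)]; simp)+
  have ny: "g 1 \<noteq> g 0" "g 2 \<noteq> g 0" "g 2 \<noteq> g 1"
    unfolding g_def by (rule ed_neq[OF y(1)]; simp)+
  have nxy: "f i \<noteq> g j" for i j
    using disj unfolding f_def g_def by blast
  have wrap: "f 3 = f 0" "f 4 = f 1" "g 3 = g 0" "g 4 = g 1"
    unfolding f_def g_def by (simp_all only: ed_eq_iff[OF x(1)] ed_eq_iff[OF y(1)]) simp_all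
  have sums: "(1 :: nat) + 1 = 2" "(1 :: nat) + 2 = 3" "(2 :: nat) + 1 = 3" "(2 :: nat) + 2 = 4"
    by simp_all
  have inj: "inj_on c F" if "f 0 \<notin> F \<or> g 0 \<notin> F" "f 1 \<notin> F \<or> g 1 \<notin> F"
      "f 2 \<notin> F \<or> g 2 \<notin> F" for F
    by (rule inj_onI) (use that nx in \<open>unfold c_def, metis\<close>)
  have x12: "\<not> conn (E - ?X) (x 1) (x 2)" and x20: "\<not> conn (E - ?X) (x 2) (x 0)"
    and x10: "\<not> conn (E - ?X) (x 1) (x 0)"
  proof -
    have "x (Suc 2) = x 0" by (simp add: cyc_eq_iff[OF x(1)])
    then show "\<not> conn (E - ?X) (x 2) (x 0)" using off_x[of 2] by simp
    show "\<not> conn (E - ?X) (x 1) (x 2)" using off_x[of 1] by (simp add: numeral_2_eq_2)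
    show "\<not> conn (E - ?X) (x 1) (x 0)" using off_x[of 0] conn_sym[of "E - ?X" "x 1"] by auto
  qed
  have y12: "\<not> conn (E - ?Y) (y 1) (y 2)" and y20: "\<not> conn (E - ?Y) (y 2) (y 0)"
    and y10: "\<not> conn (E - ?Y) (y 1) (y 0)"
  proof -
    have "y (Suc 2) = y 0" by (simp add: cyc_eq_iff[OF y(1)])
    then show "\<not> conn (E - ?Y) (y 2) (y 0)" using off_y[of 2] by simp
    show "\<not> conn (E - ?Y) (y 1) (y 2)" using off_y[of 1] by (simp add: numeral_2_eq_2)
    show "\<not> conn (E - ?Y) (y 1) (y 0)" using off_y[of 0] conn_sym[of "E - ?Y" "y 1"] by auto
  qed
  have apart: "\<not> conn (E - ?Y) v (y j)"
    if i: "i = 1 \<or> i = 2" and j: "j = 1 \<or> j = 2" and v: "conn (E - ?X) v (x i)" for v i j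
  proof
    assume vj: "conn (E - ?Y) v (y j)"
    have "\<not> conn (E - ?X) (x i) (x 0)" using i x10 x20 by blast
    from branches_disjoint[OF y(1) sub(2) ay this conn_sym[OF v]]
    have "conn (E - ?Y) (x i) v" .
    then have "conn (E - ?Y) (y j) (y 0)"
      using vj ax[of i] by (meson conn_sym conn_trans)
    then show False using j y10 y20 by blast
  qed
  have "\<exists>F\<subseteq>E. inj_on c F \<and> links F S" if S: "S \<subseteq> V" "card S = 3" for S
  proof -
    have "(\<exists>i. (i = 1 \<or> i = 2) \<and> (\<forall>v\<in>S. \<not> conn (E - ?X) v (x i))) \<or>
        (\<exists>j. (j = 1 \<or> j = 2) \<and> (\<forall>v\<in>S. \<not> conn (E - ?Y) v (y j)))"
    proof (rule ccontr)
      assume no: "\<not> ?thesis"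
      obtain v1 where v1: "v1 \<in> S" "conn (E - ?X) v1 (x 1)" using no by blast
      obtain v2 where v2: "v2 \<in> S" "conn (E - ?X) v2 (x 2)" using no by blast
      obtain w1 where w1: "w1 \<in> S" "conn (E - ?Y) w1 (y 1)" using no by blast
      obtain w2 where w2: "w2 \<in> S" "conn (E - ?Y) w2 (y 2)" using no by blast
      have "v1 \<noteq> v2" using conn_trans[OF conn_sym[OF v1(2)], of "x 2"] v2(2) x12 by blast
      moreover have "w1 \<noteq> w2" using conn_trans[OF conn_sym[OF w1(2)], of "y 2"] w2(2) y12 by blast
      moreover have "v1 \<noteq> w1" "v1 \<noteq> w2" using apart[OF _ _ v1(2)] w1(2) w2(2) by auto
      moreover have "v2 \<noteq> w1" "v2 \<noteq> w2" using apart[OF _ _ v2(2)] w1(2) w2(2) by auto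
      ultimately have "card {v1, v2, w1, w2} = 4" by simp
      moreover have "finite S" using S(2) card.infinite by fastforce
      then have "card {v1, v2, w1, w2} \<le> card S" using v1 v2 w1 w2 by (intro card_mono) simp_all
      ultimately show False using S(2) by linarith
    qed
    then show ?thesis
    proof
      assume "\<exists>i. (i = 1 \<or> i = 2) \<and> (\<forall>v\<in>S. \<not> conn (E - ?X) v (x i))"
      then obtain i where "(i = 1 \<or> i = 2) \<and> (\<forall>v\<in>S. \<not> conn (E - ?X) v (x i))" ..
      then have i: "i = 1 \<or> i = 2" "\<And>v. v \<in> S \<Longrightarrow> \<not> conn (E - ?X) v (x i)" by simp_all
      let ?F = "E - {f i, f (i + 2), g (i + 1)}"
      have "conn ?F v (x 0)" if "v \<in> S" for v
      proof -
        have "v \<in> V" using that S(1) by blast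
        from triangle_avoid_corner[OF V x(1) sub(1) i(1) this i(2)[OF that] cyc(1) gY]
        show ?thesis unfolding f_def .
      qed
      then have "links ?F S" by (rule links_from_root)
      moreover have "?F = E - {f 1, f 0, g 2} \<or> ?F = E - {f 2, f 1, g 0}"
        using i(1) by (elim disjE) (simp_all only: sums wrap simp_thms)
      then have "inj_on c ?F"
      proof
        assume F: "?F = E - {f 1, f 0, g 2}"
        show ?thesis unfolding F by (rule inj) simp_all
      next
        assume F: "?F = E - {f 2, f 1, g 0}"
        show ?thesis unfolding F by (rule inj) simp_all
      qed
      ultimately show ?thesis by blast
    next
      assume "\<exists>j. (j = 1 \<or> j = 2) \<and> (\<forall>v\<in>S. \<not> conn (E - ?Y) v (y j))"
      then obtain i where "(i = 1 \<or> i = 2) \<and> (\<forall>v\<in>S. \<not> conn (E - ?Y) v (y i))" ..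
      then have i: "i = 1 \<or> i = 2" "\<And>v. v \<in> S \<Longrightarrow> \<not> conn (E - ?Y) v (y i)" by simp_all
      let ?F = "E - {g i, g (i + 2), f (i + 1)}"
      have "conn ?F v (y 0)" if "v \<in> S" for v
      proof -
        have "v \<in> V" using that S(1) by blast
        from triangle_avoid_corner[OF V y(1) sub(2) i(1) this i(2)[OF that] cyc(2) fX]
        show ?thesis unfolding g_def .
      qed
      then have "links ?F S" by (rule links_from_root)
      moreover have "?F = E - {g 1, g 0, f 2} \<or> ?F = E - {g 2, g 1, f 0}"
        using i(1) by (elim disjE) (simp_all only: sums wrap simp_thms)
      then have "inj_on c ?F"
      proof
        assume F: "?F = E - {g 1, g 0, f 2}"
        show ?thesis unfolding F by (rule inj) simp_all
      next
        assume F: "?F = E - {g 2, g 1, f 0}"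
        show ?thesis unfolding F by (rule inj) simp_all
      qed
      ultimately show ?thesis by blast
    qed
  qed
  moreover have "E \<noteq> {}" using fE[of 0] by blast
  ultimately have "rx3 V E \<le> card (c ` E)" by (intro rx3_upper(2)[OF V subset_refl])
  moreover have "c ` E \<subseteq> E - {g 0, g 1, g 2}"
  proof (rule image_subsetI)
    fix e assume "e \<in> E"
    then show "c e \<in> E - {g 0, g 1, g 2}" using nxy fE unfolding c_def by auto
  qed
  then have "card (c ` E) \<le> card (E - {g 0, g 1, g 2})"
    using finite_edges[OF V] by (intro card_mono) simp_all
  moreover have Y3: "card {g 0, g 1, g 2} = 3" using ny[symmetric] by simp
  moreover have ysub: "{g 0, g 1, g 2} \<subseteq> E" using gE by simp
  moreover have "card {g 0, g 1, g 2} \<le> card E"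
    by (rule card_mono[OF finite_edges[OF V] ysub])
  moreover have "card (E - {g 0, g 1, g 2}) = card E - card {g 0, g 1, g 2}"
    using ysub by (intro card_Diff_subset) simp_all
  ultimately show ?thesis by linarith
qed

text \<open>
  If two corners of a triangle are connected off the triangle, three edges can be deleted without
  disconnecting the graph. Otherwise both triangles are renumbered so that each has its corner \<open>0\<close> on
  the side of the other.
\<close>

lemma rx3_two_triangles:
  assumes V: "connected_graph V E" "card V \<ge> 3"
    and C: "is_cycle E C" "card C = 3" and D: "is_cycle E D" "card D = 3"
    and disj: "C \<inter> D = {}"
  shows "rx3 V E + 3 \<le> card E"
proof -
  from is_cycle_of_length[OF C] obtain x where x: "cyc 3 x" "C = range (ed x)" "C \<subseteq> E" .
  from is_cycle_of_length[OF D] obtain y where y: "cyc 3 y" "D = range (ed y)" "D \<subseteq> E" .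
  have sub: "range (ed x) \<subseteq> E" "range (ed y) \<subseteq> E" using x y by simp_all
  have d: "range (ed x) \<inter> range (ed y) = {}" using disj x(2) y(2) by simp
  consider (bypass_x) i where "conn (E - range (ed x)) (x i) (x (Suc i))"
    | (bypass_y) i where "conn (E - range (ed y)) (y i) (y (Suc i))"
    | (none) "\<forall>i. \<not> conn (E - range (ed x)) (x i) (x (Suc i))"
      "\<forall>i. \<not> conn (E - range (ed y)) (y i) (y (Suc i))" by blast
  then show ?thesis
  proof cases
    case bypass_x
    then show ?thesis
      using rx3_bypassed_cycle[OF V x(1) sub(1) D(1)] d y(2) by simp
  next
    case bypass_y
    then show ?thesis
      using rx3_bypassed_cycle[OF V y(1) sub(2) C(1)] d x(2) by (simp add: Int_commute)
  next
    case none
    from conn_to_cycle[OF V(1) x(1) sub(1) cycle_vertices[OF V(1) sub(2), of 0]]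
    obtain r where r: "conn (E - range (ed x)) (y 0) (x r)" .
    from conn_to_cycle[OF V(1) y(1) sub(2) cycle_vertices[OF V(1) sub(1), of 0]]
    obtain q where q: "conn (E - range (ed y)) (x 0) (y q)" .
    define x' where "x' i = x (i + r)" for i
    define y' where "y' i = y (i + q)" for i
    have rx: "range (ed x') = range (ed x)" unfolding x'_def by (rule range_ed_shift[OF x(1)])
    have ry: "range (ed y') = range (ed y)" unfolding y'_def by (rule range_ed_shift[OF y(1)])
    have "C \<subseteq> E - D" "D \<subseteq> E - C" using x(3) y(3) disj by blast+
    from this[unfolded x(2) y(2)]
    have l: "links (E - range (ed y)) (range x)" "links (E - range (ed x)) (range y)"
      by (simp_all only: cycle_linked)
    show ?thesis
    proof (rule rx3_two_triangles_based[OF V(1), of x' y'], unfold rx ry)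
      show "cyc 3 x'" unfolding x'_def by (rule cyc_shift[OF x(1)])
      show "cyc 3 y'" unfolding y'_def by (rule cyc_shift[OF y(1)])
      show "is_cycle E (range (ed x))" "is_cycle E (range (ed y))" using C D x y by simp_all
      show "range (ed x) \<inter> range (ed y) = {}" by (rule d)
      show "\<not> conn (E - range (ed x)) (x' i) (x' (Suc i))" for i
        using none(1) by (simp add: x'_def)
      show "\<not> conn (E - range (ed y)) (y' i) (y' (Suc i))" for i
        using none(2) by (simp add: y'_def)
      show "conn (E - range (ed x)) (y' j) (x' 0)" for j
      proof (rule conn_trans)
        show "conn (E - range (ed x)) (y' j) (y 0)" using l(2) by (simp add: links_def y'_def)
        show "conn (E - range (ed x)) (y 0) (x' 0)" using r by (simp add: x'_def)
      qed
      show "conn (E - range (ed y)) (x' j) (y' 0)" for j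
      proof (rule conn_trans)
        show "conn (E - range (ed y)) (x' j) (x 0)" using l(1) by (simp add: links_def x'_def)
        show "conn (E - range (ed y)) (x 0) (y' 0)" using q by (simp add: y'_def)
      qed
    qed
  qed
qed

text \<open>
  The four edges other than the common one form a cycle through both apexes.
\<close>

lemma triangles_sharing_an_edge:
  assumes C: "is_cycle E C" "card C = 3" and D: "is_cycle E D" "card D = 3"
    and CD: "C \<noteq> D" "C \<inter> D \<noteq> {}"
  obtains Q where "is_cycle E Q" "card Q = 4"
proof -
  from is_cycle_of_length[OF C] obtain x where x: "cyc 3 x" "C = range (ed x)" "C \<subseteq> E" .
  from is_cycle_of_length[OF D] obtain y where y: "cyc 3 y" "D = range (ed y)" "D \<subseteq> E" .
  obtain i j where ij: "ed x i = ed y j" using CD(2) x(2) y(2) by auto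
  let ?a = "x i" and ?b = "x (Suc i)" and ?c = "x (Suc (Suc i))" and ?d = "y (Suc (Suc j))"
  have xwrap: "x (Suc (Suc (Suc n))) = x n" and ywrap: "y (Suc (Suc (Suc n))) = y n" for n
  proof -
    have n3: "Suc (Suc (Suc n)) = n + 3" by simp
    show "x (Suc (Suc (Suc n))) = x n" unfolding n3 by (simp add: cyc_eq_iff[OF x(1)])
    show "y (Suc (Suc (Suc n))) = y n" unfolding n3 by (simp add: cyc_eq_iff[OF y(1)])
  qed
  have triangle: "range (ed z) = {{z n, z (Suc n)}, {z (Suc n), z (Suc (Suc n))},
      {z (Suc (Suc n)), z n}}"
    if z: "cyc 3 z" "\<And>n. z (Suc (Suc (Suc n))) = z n" for z :: "nat \<Rightarrow> 'a" and n
  proof -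
    have "range (ed z) = range (ed (\<lambda>m. z (m + n)))" using range_ed_shift[OF z(1)] by simp
    also have "\<dots> = ed (\<lambda>m. z (m + n)) ` {..<3}" by (rule range_ed[OF cyc_shift[OF z(1)]])
    also have "{..<3} = {0, 1, 2 :: nat}" by auto
    finally show ?thesis using z(2)[of n] by (simp add: numeral_2_eq_2)
  qed
  have Cx: "C = {{?a, ?b}, {?b, ?c}, {?c, ?a}}" using triangle[OF x(1) xwrap] x(2) by simp
  have Dy: "D = {{y j, y (Suc j)}, {y (Suc j), ?d}, {?d, y j}}"
    using triangle[OF y(1) ywrap] y(2) by simp
  have ends: "y j = ?a \<and> y (Suc j) = ?b \<or> y j = ?b \<and> y (Suc j) = ?a"
    using ij by (auto simp: doubleton_eq_iff)
  then have Dx: "D = {{?a, ?b}, {?b, ?d}, {?d, ?a}}"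
    by (elim disjE conjE) (simp_all only: Dy insert_commute)
  have "?a \<noteq> ?b" "?b \<noteq> ?c" "?a \<noteq> ?c"
    unfolding cyc_eq_iff[OF x(1)] by presburger+
  moreover have "y j \<noteq> ?d" "y (Suc j) \<noteq> ?d"
    unfolding cyc_eq_iff[OF y(1)] by presburger+
  then have "?a \<noteq> ?d" "?b \<noteq> ?d" using ends by metis+
  moreover have "?c \<noteq> ?d"
  proof
    assume "?c = ?d"
    then have "C = D" unfolding Cx Dx by simp
    then show False using CD(1) by simp
  qed
  ultimately have dist: "distinct [?a, ?c, ?b, ?d]" by simp
  let ?Q = "cyclic_edges [?a, ?c, ?b, ?d]"
  have "?Q = (\<lambda>i. {[?a, ?c, ?b, ?d] ! i, [?a, ?c, ?b, ?d] ! (Suc i mod 4)}) ` {..<4}"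
    unfolding cyclic_edges_def by auto
  also have "{..<4} = {0, 1, 2, 3 :: nat}" by auto
  finally have Q: "?Q = {{?a, ?c}, {?c, ?b}, {?b, ?d}, {?d, ?a}}" by simp
  have "{?c, ?a} \<in> E" "{?b, ?c} \<in> E" using x(3) unfolding Cx by simp_all
  then have "{?a, ?c} \<in> E" "{?c, ?b} \<in> E" by (simp_all only: insert_commute)
  moreover have "{?b, ?d} \<in> E" "{?d, ?a} \<in> E" using y(3) unfolding Dx by simp_all
  ultimately have "?Q \<subseteq> E" unfolding Q by simp
  then have "is_cycle E ?Q" using dist unfolding is_cycle_def
    by (intro conjI exI[of _ "[?a, ?c, ?b, ?d]"]) simp_all
  moreover have "3 \<le> length [?a, ?c, ?b, ?d]" by simp
  from cyclic_edges_cycE[OF dist this] obtain z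
    where z: "cyc (length [?a, ?c, ?b, ?d]) z" "?Q = range (ed z)" .
  have "card ?Q = 4" using card_range_ed[OF z(1)] unfolding z(2) by simp
  ultimately show ?thesis using that by blast
qed

text \<open>
  A long cycle survives the deletion of an edge of a different cycle, which cannot lie
  entirely on the long one.
\<close>

lemma rx3_two_cycles:
  assumes V: "connected_graph V E" "card V \<ge> 3"
    and C: "is_cycle E C" and D: "is_cycle E D" and CD: "C \<noteq> D"
  shows "rx3 V E + 3 \<le> card E"
proof -
  have long: "rx3 V E + 3 \<le> card E"
    if Q: "is_cycle E Q" "4 \<le> card Q" and R: "is_cycle E R" "R \<noteq> Q" for Q R
  proof -
    have "\<not> R \<subseteq> Q" using cycle_minimal[OF R(1) Q(1)] R(2) by blast
    then obtain e where e: "e \<in> R" "e \<notin> Q" by blast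
    from is_cycle_of_length[OF Q(1) refl] obtain x
      where x: "cyc (card Q) x" "Q = range (ed x)" "Q \<subseteq> E" .
    have V': "connected_graph V (E - {e})"
      by (rule connected_remove_cycle_edge[OF V(1) R(1) e(1)])
    have "range (ed x) \<subseteq> E - {e}" using x e(2) by blast
    from rx3_long_cycle[OF V(1) _ V' x(1) this Q(2)]
    have "rx3 V E + 2 \<le> card (E - {e})" by blast
    moreover have "e \<in> E" using R(1) e(1) by (auto simp: is_cycle_def)
    then have "card E = Suc (card (E - {e}))"
      by (rule card.remove[OF finite_edges[OF V(1)]])
    ultimately show ?thesis by linarith
  qed
  show ?thesis
  proof (cases "\<exists>Q. is_cycle E Q \<and> 4 \<le> card Q")
    case True
    then obtain Q where Q: "is_cycle E Q" "4 \<le> card Q" by blast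
    show ?thesis
    proof (cases "C = Q")
      case True
      then have "D \<noteq> Q" using CD by simp
      with Q D show ?thesis by (intro long)
    qed (use Q C in \<open>intro long\<close>)
  next
    case False
    have three: "card R = 3" if "is_cycle E R" for R
    proof -
      have "\<not> 4 \<le> card R" using False that by blast
      then show ?thesis using card_cycle_ge_3[OF that] by linarith
    qed
    have "C \<inter> D = {}"
    proof (rule ccontr)
      assume "C \<inter> D \<noteq> {}"
      from triangles_sharing_an_edge[OF C three[OF C] D three[OF D] CD this]
      obtain Q where "is_cycle E Q" "card Q = 4" .
      then show False using False by auto
    qed
    then show ?thesis by (rule rx3_two_triangles[OF V C three[OF C] D three[OF D]])
  qed
qed

lemma rx3_tree:
  assumes "is_tree V E" "card V \<ge> 3"
  shows "rx3 V E = card E"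
proof -
  have V: "connected_graph V E" and none: "\<And>C. \<not> is_cycle E C"
    using assms(1) by (simp_all add: is_tree_def)
  from rx3_attained[OF V assms(2)] obtain c :: "'a set \<Rightarrow> nat"
    where c: "rainbow3_coloring V E c" "card (c ` E) \<le> rx3 V E" .
  have "inj_on c E" by (rule bridges_inj_on[OF V assms(2) c(1)]) (simp_all add: none)
  then have "card E \<le> rx3 V E" using c(2) by (simp add: card_image)
  moreover have "rx3 V E \<le> card E"
    by (rule rx3_le_spanning[OF V subset_refl edges_nonempty[OF V assms(2)] V])
  ultimately show ?thesis by linarith
qed

lemma rx3_unicyclic:
  assumes V: "connected_graph V E" "card V \<ge> 3" and C: "is_cycle E C"
    and unique: "\<And>D. is_cycle E D \<Longrightarrow> D = C"
  shows "rx3 V E + (if card C = 3 then 1 else 2) = card E"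
proof -
  from is_cycle_cycE[OF C] obtain k x
    where x: "cyc k x" "C = range (ed x)" "C \<subseteq> E" "card C = k" .
  have sub: "range (ed x) \<subseteq> E" using x by simp
  have un: "\<And>D. is_cycle E D \<Longrightarrow> D = range (ed x)" using unique x(2) by simp
  have k3: "3 \<le> k" using x(1) by (simp add: cyc_def)
  from rx3_attained[OF V] obtain c :: "'a set \<Rightarrow> nat"
    where c: "rainbow3_coloring V E c" "card (c ` E) \<le> rx3 V E" .
  have lower: "card E \<le> rx3 V E + d" if "1 \<le> d" "k = 3 \<or> 2 \<le> d" for d
    using unicyclic_lower_bound[OF V c(1) x(1) sub un that] c(2) by linarith
  show ?thesis
  proof (cases "k = 3")
    case True
    then show ?thesis using lower[of 1] rx3_remove_cycle_edge[OF V C] x(4) by simp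
  next
    case False
    then have "4 \<le> k" using k3 by linarith
    then have "rx3 V E + 2 \<le> card E" by (rule rx3_long_cycle[OF V(1) subset_refl V(1) x(1) sub])
    then show ?thesis using lower[of 2] x(4) False by simp
  qed
qed

theorem theorem4:
  fixes V :: "'a set" and E :: "'a set set" and m :: nat
  assumes "connected_graph V E" and "card V \<ge> 3" and "m = card E"
  shows "(int (rx3 V E) = int m \<longleftrightarrow> is_tree V E)
       \<and> (int (rx3 V E) = int m - 1 \<longleftrightarrow> unicyclic V E \<and> unicyclic_girth E = 3)
       \<and> (int (rx3 V E) = int m - 2 \<longleftrightarrow> unicyclic V E \<and> unicyclic_girth E \<ge> 4)"
proof -
  consider (tree) "\<And>C. \<not> is_cycle E C"
    | (one) C where "is_cycle E C" "\<And>D. is_cycle E D \<Longrightarrow> D = C"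
    | (two) C D where "is_cycle E C" "is_cycle E D" "C \<noteq> D" by blast
  then show ?thesis
  proof cases
    case tree
    then have "is_tree V E" "\<not> unicyclic V E"
      using assms(1) by (auto simp: is_tree_def unicyclic_def)
    then show ?thesis using rx3_tree[OF _ assms(2)] assms(3) by simp
  next
    case one
    have u: "unicyclic V E" "\<not> is_tree V E"
      using assms(1) one by (auto simp: is_tree_def unicyclic_def)
    have "(THE C. is_cycle E C) = C" using one by (intro the_equality)
    then have g: "unicyclic_girth E = card C" by (simp add: unicyclic_girth_def)
    show ?thesis
      using card_cycle_ge_3[OF one(1)] rx3_unicyclic[OF assms(1,2) one] u g assms(3) by (auto split: if_splits)
  next
    case two
    then have "\<not> unicyclic V E" "\<not> is_tree V E" by (auto simp: is_tree_def unicyclic_def)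
    then show ?thesis using rx3_two_cycles[OF assms(1,2) two] assms(3) by simp
  qed
qed

end
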